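(* Let $M^2$ be a marginally trapped surface in the Minkowski space $\mathbb{R}^4_1$ which is free of flat points. Then $M^2$ is of pointwise 1-type Gauss map if and only if $M^2$ has parallel mean curvature vector field.
   Context: **Ambient space.** $\mathbb{R}^4_1$ is the four-dimensional Minkowski space, i.e. $\mathbb{R}^4$ with the flat metric $\langle\cdot,\cdot\rangle = dx_1^2+dx_2^2+dx_3^2-dx_4^2$, and $\nabla'$ denotes its Levi-Civita connection. Surfaces are smooth and are considered locally, given by a parametrization $z=z(u,v)$, $(u,v)\in\mathcal D\subset\mathbb{R}^2$, and oriented. **Spacelike surfaces.** A surface $M^2$ in $\mathbb{R}^4_1$ is spacelike if $\langle\cdot,\cdot\rangle$ induces a Riemannian metric on $M^2$. Then $\mathbb{R}^4_1=T_pM^2\oplus N_pM^2$ at each $p\in M^2$, with the metric of signature $(2,0)$ on $T_pM^2$ and $(1,1)$ on the normal space $N_pM^2$. Let $\nabla$ be the Levi-Civita connection of $M^2$. For tangent vector fields $x,y$ and a normal vector field $\xi$ write $\nabla'_x y=\nabla_x y+\sigma(x,y)$ and $\nabla'_x\xi=-A_\xi x+D_x\xi$, the decompositions into tangent and normal parts; $\sigma$ is the second fundamental tensor and $D$ the normal connection. The mean curvature vector field is $H=\frac12\,\mathrm{tr}\,\sigma=\frac12(\sigma(x,x)+\sigma(y,y))$ for any local orthonormal tangent frame $\{x,y\}$. **Marginally trapped.** $M^2$ is marginally trapped if it is spacelike and $H$ is lightlike at each point, i.e. $\langle H,H\rangle=0$ and $H\neq0$ at every point (the surface is not required to be closed or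 embedded). **Parallel mean curvature vector field.** This means $DH=0$ identically on $M^2$, i.e. $D_xH=0$ for every tangent $x$. **Flat points.** Let $E=\langle z_u,z_u\rangle$, $F=\langle z_u,z_v\rangle$, $G=\langle z_v,z_v\rangle$ (here $G$ is a coefficient of the first fundamental form, not the Gauss map), $W=\sqrt{EG-F^2}$. Let $\{n_1,n_2\}$ be a normal frame field with $\langle n_1,n_1\rangle=1$, $\langle n_2,n_2\rangle=-1$, $\langle n_1,n_2\rangle=0$ and $\{z_u,z_v,n_1,n_2\}$ positively oriented. Put $c_{11}^k=\langle z_{uu},n_k\rangle$, $c_{12}^k=\langle z_{uv},n_k\rangle$, $c_{22}^k=\langle z_{vv},n_k\rangle$, $k=1,2$, and $$L=\frac{2}{W}\left(c_{11}^1c_{12}^2-c_{12}^1c_{11}^2\right),\quad M=\frac1W\left(c_{11}^1c_{22}^2-c_{22}^1c_{11}^2\right),\quad N=\frac2W\left(c_{12}^1c_{22}^2-c_{22}^1c_{12}^2\right).$$ A point is called flat if $L=M=N=0$ there (for a surface with $\sigma\ne 0$ at the point, equivalently: the linear span of $\{\sigma(x,y): x,y\in T_pM^2\}$ is one-dimensional). $M^2$ is free of flat points if $(L,M,N)\neq(0,0,0)$ at every point. **Gauss map and Laplacian.** From now on $G$ denotes the Gauss map. It is the map $G:M^2\to\wedge^2\mathbb{R}^4_1$, $G(p)=(x\wedge y)(p)$, where $\{x,y\}$ is a positively oriented local orthonormal tangent frame of $M^2$. The Laplacian of a (vector-valued) function $f$ on $M^2$ is $$\Delta f=-\sum_{i=1}^2\left(\nabla'_{e_i}\nabla'_{e_i}f-\nabla'_{\nabla_{e_i}e_i}f\right)$$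 for a local orthonormal tangent frame $\{e_1,e_2\}$, where for $\wedge^2\mathbb{R}^4_1$-valued functions $\nabla'$ is the flat (componentwise) derivative. **Pointwise 1-type Gauss map.** $M^2$ is of (has) pointwise 1-type Gauss map if $\Delta G=\phi\,(G+C)$ on $M^2$ for some smooth function $\phi$ on $M^2$ and some constant vector $C\in\wedge^2\mathbb{R}^4_1$ (with $C=0$ and constant $\phi$ allowed). *)

theory Defs
  imports "HOL-Analysis.Analysis"
begin

section \<open>Smooth maps on open sets\<close>

text \<open>On an open subset of a Euclidean space, \<open>Ck_on n f S\<close> is the usual class of $n$ times
  continuously differentiable maps: all iterated directional derivatives up to order \<open>n\<close> exist
  (as Frechet derivatives) and are continuous.\<close>

primrec Ck_on :: "nat \<Rightarrow> ('a::real_normed_vector \<Rightarrow> 'b::real_normed_vector) \<Rightarrow> 'a set \<Rightarrow> bool" where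
  "Ck_on 0 f S \<longleftrightarrow> continuous_on S f"
| "Ck_on (Suc n) f S \<longleftrightarrow>
     (\<forall>p\<in>S. f differentiable (at p)) \<and> (\<forall>a. Ck_on n (\<lambda>p. frechet_derivative f (at p) a) S)"

definition smooth_on :: "('a::real_normed_vector \<Rightarrow> 'b::real_normed_vector) \<Rightarrow> 'a set \<Rightarrow> bool" where
  "smooth_on f S \<longleftrightarrow> (\<forall>n. Ck_on n f S)"

section \<open>Minkowski space\<close>

definition mink :: "real^4 \<Rightarrow> real^4 \<Rightarrow> real" where
  "mink x y = x$1 * y$1 + x$2 * y$2 + x$3 * y$3 - x$4 * y$4"

definition lightlike :: "real^4 \<Rightarrow> bool" where
  "lightlike x \<longleftrightarrow> mink x x = 0 \<and> x \<noteq> 0"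

text \<open>The exterior square is realised as the space of antisymmetric contravariant 2-tensors,
  with $x \wedge y = x \otimes y - y \otimes x$.\<close>

definition bivectors :: "(real^4^4) set" where
  "bivectors = {C. transpose C = - C}"

definition wedge :: "real^4 \<Rightarrow> real^4 \<Rightarrow> real^4^4" where
  "wedge x y = (\<chi> i j. x$i * y$j - y$i * x$j)"

section \<open>Parametrized surfaces\<close>

text \<open>A surface is given by a parametrization \<open>z\<close> and oriented by it. Functions on the surface are
  functions of the parameters. A tangent vector field is given by its coordinates with respect to
  \<open>z\<^sub>u, z\<^sub>v\<close>, i.e. by a map \<open>X\<close> from the parameter domain to the plane; the corresponding vector
  field in Minkowski space is \<open>push z X\<close>.\<close>

type_synonym param = "real \<times> real \<Rightarrow> real^4"
type_synonym tfield = "real \<times> real \<Rightarrow> real \<times> real"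

text \<open>The flat connection: derivative of a vector-valued function along the tangent field \<open>X\<close>.\<close>

definition flatD :: "tfield \<Rightarrow> (real \<times> real \<Rightarrow> 'b::real_normed_vector) \<Rightarrow> real \<times> real \<Rightarrow> 'b" where
  "flatD X f p = frechet_derivative f (at p) (X p)"

definition push :: "param \<Rightarrow> tfield \<Rightarrow> real \<times> real \<Rightarrow> real^4" where
  "push z X = flatD X z"

definition du :: "(real \<times> real \<Rightarrow> 'b::real_normed_vector) \<Rightarrow> real \<times> real \<Rightarrow> 'b" where
  "du f = flatD (\<lambda>_. (1, 0)) f"

definition dv :: "(real \<times> real \<Rightarrow> 'b::real_normed_vector) \<Rightarrow> real \<times> real \<Rightarrow> 'b" where
  "dv f = flatD (\<lambda>_. (0, 1)) f"

definition EE :: "param \<Rightarrow> real \<times> real \<Rightarrow> real" where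
  "EE z p = mink (du z p) (du z p)"

definition FF :: "param \<Rightarrow> real \<times> real \<Rightarrow> real" where
  "FF z p = mink (du z p) (dv z p)"

definition GG :: "param \<Rightarrow> real \<times> real \<Rightarrow> real" where
  "GG z p = mink (dv z p) (dv z p)"

definition WW :: "param \<Rightarrow> real \<times> real \<Rightarrow> real" where
  "WW z p = sqrt (EE z p * GG z p - (FF z p)\<^sup>2)"

text \<open>The induced metric is positive definite; in particular \<open>z\<close> is an immersion.\<close>

definition spacelike_surface :: "(real \<times> real) set \<Rightarrow> param \<Rightarrow> bool" where
  "spacelike_surface D z \<longleftrightarrow> open D \<and> smooth_on z D \<and>
     (\<forall>p\<in>D. \<forall>a. a \<noteq> 0 \<longrightarrow>
        0 < mink (frechet_derivative z (at p) a) (frechet_derivative z (at p) a))"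

section \<open>Tangent and normal parts, induced connections\<close>

text \<open>Coordinates with respect to \<open>z\<^sub>u, z\<^sub>v\<close> of the tangent part of a vector \<open>w\<close> at \<open>p\<close>, by
  Cramer's rule applied to the Gram system.\<close>

definition tan_coords :: "param \<Rightarrow> real \<times> real \<Rightarrow> real^4 \<Rightarrow> real \<times> real" where
  "tan_coords z p w =
     ((GG z p * mink w (du z p) - FF z p * mink w (dv z p)) / (EE z p * GG z p - (FF z p)\<^sup>2),
      (EE z p * mink w (dv z p) - FF z p * mink w (du z p)) / (EE z p * GG z p - (FF z p)\<^sup>2))"

definition normal_part :: "param \<Rightarrow> real \<times> real \<Rightarrow> real^4 \<Rightarrow> real^4" where
  "normal_part z p w = w - frechet_derivative z (at p) (tan_coords z p w)"

definition normal_vector :: "param \<Rightarrow> real \<times> real \<Rightarrow> real^4 \<Rightarrow> bool" where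
  "normal_vector z p w \<longleftrightarrow> mink w (du z p) = 0 \<and> mink w (dv z p) = 0"

definition levi_civita :: "param \<Rightarrow> tfield \<Rightarrow> tfield \<Rightarrow> tfield" where
  "levi_civita z X Y p = tan_coords z p (flatD X (push z Y) p)"

definition sff :: "param \<Rightarrow> tfield \<Rightarrow> tfield \<Rightarrow> real \<times> real \<Rightarrow> real^4" where
  "sff z X Y p = normal_part z p (flatD X (push z Y) p)"

definition normal_connection ::
    "param \<Rightarrow> tfield \<Rightarrow> (real \<times> real \<Rightarrow> real^4) \<Rightarrow> real \<times> real \<Rightarrow> real^4" where
  "normal_connection z X \<xi> p = normal_part z p (flatD X \<xi> p)"

text \<open>The positively oriented orthonormal tangent frame obtained from \<open>z\<^sub>u, z\<^sub>v\<close> by the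
  Gram-Schmidt process: \<open>z\<^sub>u / \<surd>E\<close> and \<open>(E z\<^sub>v - F z\<^sub>u) / (\<surd>E W)\<close>. The mean curvature vector, the
  Gauss map and the Laplacian do not depend on the choice of such a frame.\<close>

definition frame1 :: "param \<Rightarrow> tfield" where
  "frame1 z p = (1 / sqrt (EE z p), 0)"

definition frame2 :: "param \<Rightarrow> tfield" where
  "frame2 z p = (- FF z p / (sqrt (EE z p) * WW z p), sqrt (EE z p) / WW z p)"

section \<open>Mean curvature and flat points\<close>

definition mean_curvature :: "param \<Rightarrow> real \<times> real \<Rightarrow> real^4" where
  "mean_curvature z p =
     (1/2) *\<^sub>R (sff z (frame1 z) (frame1 z) p + sff z (frame2 z) (frame2 z) p)"

definition marginally_trapped :: "(real \<times> real) set \<Rightarrow> param \<Rightarrow> bool" where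
  "marginally_trapped D z \<longleftrightarrow> spacelike_surface D z \<and> (\<forall>p\<in>D. lightlike (mean_curvature z p))"

definition parallel_mean_curvature :: "(real \<times> real) set \<Rightarrow> param \<Rightarrow> bool" where
  "parallel_mean_curvature D z \<longleftrightarrow>
     (\<forall>X. \<forall>p\<in>D. normal_connection z X (mean_curvature z) p = 0)"

definition normal_frame_at :: "param \<Rightarrow> real \<times> real \<Rightarrow> real^4 \<Rightarrow> real^4 \<Rightarrow> bool" where
  "normal_frame_at z p n1 n2 \<longleftrightarrow> normal_vector z p n1 \<and> normal_vector z p n2 \<and>
     mink n1 n1 = 1 \<and> mink n2 n2 = -1 \<and> mink n1 n2 = 0 \<and>
     0 < det (vector [du z p, dv z p, n1, n2] :: real^4^4)"

definition LL :: "param \<Rightarrow> real \<times> real \<Rightarrow> real^4 \<Rightarrow> real^4 \<Rightarrow> real" where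
  "LL z p n1 n2 = 2 / WW z p *
     (mink (du (du z) p) n1 * mink (dv (du z) p) n2 - mink (dv (du z) p) n1 * mink (du (du z) p) n2)"

definition MM :: "param \<Rightarrow> real \<times> real \<Rightarrow> real^4 \<Rightarrow> real^4 \<Rightarrow> real" where
  "MM z p n1 n2 = 1 / WW z p *
     (mink (du (du z) p) n1 * mink (dv (dv z) p) n2 - mink (dv (dv z) p) n1 * mink (du (du z) p) n2)"

definition NN :: "param \<Rightarrow> real \<times> real \<Rightarrow> real^4 \<Rightarrow> real^4 \<Rightarrow> real" where
  "NN z p n1 n2 = 2 / WW z p *
     (mink (dv (du z) p) n1 * mink (dv (dv z) p) n2 - mink (dv (dv z) p) n1 * mink (dv (du z) p) n2)"

text \<open>Two frames as in \<^const>\<open>normal_frame_at\<close> differ by an element of $SO(1,1)$, so \<open>L, M, N\<close> do not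
  depend on the frame, and \<open>\<exists>\<close> below could equally be \<open>\<forall>\<close>. Such frames exist at every point of a
  spacelike surface; see \<open>ex_normal_frame_at\<close> below.\<close>

definition flat_point :: "param \<Rightarrow> real \<times> real \<Rightarrow> bool" where
  "flat_point z p \<longleftrightarrow> (\<exists>n1 n2. normal_frame_at z p n1 n2 \<and>
     LL z p n1 n2 = 0 \<and> MM z p n1 n2 = 0 \<and> NN z p n1 n2 = 0)"

definition free_of_flat_points :: "(real \<times> real) set \<Rightarrow> param \<Rightarrow> bool" where
  "free_of_flat_points D z \<longleftrightarrow> (\<forall>p\<in>D. \<not> flat_point z p)"

section \<open>Gauss map and Laplacian\<close>

definition gauss_map :: "param \<Rightarrow> real \<times> real \<Rightarrow> real^4^4" where
  "gauss_map z p = wedge (push z (frame1 z) p) (push z (frame2 z) p)"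

definition laplacian ::
    "param \<Rightarrow> (real \<times> real \<Rightarrow> 'b::real_normed_vector) \<Rightarrow> real \<times> real \<Rightarrow> 'b" where
  "laplacian z f p = - (\<Sum>e\<leftarrow>[frame1 z, frame2 z].
     flatD e (flatD e f) p - flatD (levi_civita z e e) f p)"

definition pointwise_1_type_gauss_map :: "(real \<times> real) set \<Rightarrow> param \<Rightarrow> bool" where
  "pointwise_1_type_gauss_map D z \<longleftrightarrow> (\<exists>\<phi> C. smooth_on \<phi> D \<and> C \<in> bivectors \<and>
     (\<forall>p\<in>D. laplacian z (gauss_map z) p = \<phi> p *\<^sub>R (gauss_map z p + C)))"

section \<open>Consistency of the definitions\<close>

lemma mink_simps:
  "mink (x + y) w = mink x w + mink y w" "mink w (x + y) = mink w x + mink w y"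
  "mink (x - y) w = mink x w - mink y w" "mink w (x - y) = mink w x - mink w y"
  "mink (c *\<^sub>R x) w = c * mink x w" "mink w (c *\<^sub>R x) = c * mink w x"
  by (simp_all add: mink_def algebra_simps)

lemma mink_commute: "mink x y = mink y x"
  by (simp add: mink_def mult.commute)

lemma spacelike_differentiable:
  assumes "spacelike_surface D z" "p \<in> D"
  shows "z differentiable (at p)"
proof -
  have "Ck_on (Suc 0) z D"
    using assms unfolding spacelike_surface_def smooth_on_def by blast
  then show ?thesis
    using assms by auto
qed

lemma derivative_eq:
  assumes "z differentiable (at p)"
  shows "frechet_derivative z (at p) (a, b) = a *\<^sub>R du z p + b *\<^sub>R dv z p"
proof -
  interpret linear "frechet_derivative z (at p)"
    using assms by (rule linear_frechet_derivative)
  have "(a, b) = a *\<^sub>R (1, 0) + b *\<^sub>R (0, 1::real)" for a b :: real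
    by simp
  then show ?thesis
    unfolding du_def dv_def flatD_def by (metis add scale)
qed

lemma spacelike_pos:
  assumes "spacelike_surface D z" "p \<in> D"
  shows "0 < EE z p" "0 < EE z p * GG z p - (FF z p)\<^sup>2"
proof -
  note d = derivative_eq[OF spacelike_differentiable[OF assms]]
  have q: "0 < a\<^sup>2 * EE z p + 2 * a * b * FF z p + b\<^sup>2 * GG z p" if "(a, b) \<noteq> 0" for a b
  proof -
    have "0 < mink (frechet_derivative z (at p) (a, b)) (frechet_derivative z (at p) (a, b))"
      using assms that unfolding spacelike_surface_def by blast
    then show ?thesis
      unfolding d by (simp add: mink_simps EE_def FF_def GG_def
          mink_commute[of "dv z p" "du z p"] power2_eq_square algebra_simps)
  qed
  show E: "0 < EE z p"
    using q[of 1 0] by (simp add: zero_prod_def)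
  have "0 < EE z p * (EE z p * GG z p - (FF z p)\<^sup>2)"
    using q[of "- FF z p" "EE z p"] E
    by (simp add: zero_prod_def power2_eq_square algebra_simps)
  then show "0 < EE z p * GG z p - (FF z p)\<^sup>2"
    using E by (simp add: zero_less_mult_iff)
qed

lemma normal_part_normal:
  assumes "spacelike_surface D z" "p \<in> D"
  shows "normal_vector z p (normal_part z p w)"
proof -
  define \<delta> where "\<delta> = EE z p * GG z p - (FF z p)\<^sup>2"
  have "\<delta> \<noteq> 0"
    using spacelike_pos[OF assms] by (simp add: \<delta>_def)
  then show ?thesis
    unfolding normal_vector_def normal_part_def tan_coords_def \<delta>_def[symmetric]
      derivative_eq[OF spacelike_differentiable[OF assms]]
    apply (simp add: mink_simps mink_commute[of "dv z p" "du z p"]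
        EE_def[symmetric] FF_def[symmetric] GG_def[symmetric] divide_simps)
    apply (simp add: \<delta>_def power2_eq_square algebra_simps)
    done
qed

lemma frame_orthonormal:
  assumes "spacelike_surface D z" "p \<in> D"
  shows "mink (push z (frame1 z) p) (push z (frame1 z) p) = 1"
    and "mink (push z (frame1 z) p) (push z (frame2 z) p) = 0"
    and "mink (push z (frame2 z) p) (push z (frame2 z) p) = 1"
proof -
  define s where "s = sqrt (EE z p)"
  define w where "w = WW z p"
  have E: "EE z p = s\<^sup>2" and s: "s > 0"
    using spacelike_pos[OF assms] by (simp_all add: s_def)
  have w2: "w\<^sup>2 = s\<^sup>2 * GG z p - (FF z p)\<^sup>2" and w: "w > 0"
    using spacelike_pos[OF assms] E by (simp_all add: w_def WW_def)
  note * = push_def flatD_def frame1_def frame2_def s_def[symmetric] w_def[symmetric]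
    derivative_eq[OF spacelike_differentiable[OF assms]] mink_simps
    mink_commute[of "dv z p" "du z p"] EE_def[symmetric] FF_def[symmetric] GG_def[symmetric] E
  show "mink (push z (frame1 z) p) (push z (frame1 z) p) = 1"
    and "mink (push z (frame1 z) p) (push z (frame2 z) p) = 0"
    using s w unfolding * by (simp_all add: field_simps power2_eq_square)
  have "mink (push z (frame2 z) p) (push z (frame2 z) p) = (s\<^sup>2 * GG z p - (FF z p)\<^sup>2) / w\<^sup>2"
    using s w unfolding * by (simp add: divide_simps) (simp add: power2_eq_square algebra_simps)
  then show "mink (push z (frame2 z) p) (push z (frame2 z) p) = 1"
    using w by (simp add: w2[symmetric])
qed

lemma det_4:
  "det (A :: real^4^4) =
     A$1$1 * (A$2$2 * (A$3$3 * A$4$4 - A$3$4 * A$4$3) - A$2$3 * (A$3$2 * A$4$4 - A$3$4 * A$4$2)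
            + A$2$4 * (A$3$2 * A$4$3 - A$3$3 * A$4$2))
   - A$1$2 * (A$2$1 * (A$3$3 * A$4$4 - A$3$4 * A$4$3) - A$2$3 * (A$3$1 * A$4$4 - A$3$4 * A$4$1)
            + A$2$4 * (A$3$1 * A$4$3 - A$3$3 * A$4$1))
   + A$1$3 * (A$2$1 * (A$3$2 * A$4$4 - A$3$4 * A$4$2) - A$2$2 * (A$3$1 * A$4$4 - A$3$4 * A$4$1)
            + A$2$4 * (A$3$1 * A$4$2 - A$3$2 * A$4$1))
   - A$1$4 * (A$2$1 * (A$3$2 * A$4$3 - A$3$3 * A$4$2) - A$2$2 * (A$3$1 * A$4$3 - A$3$3 * A$4$1)
            + A$2$3 * (A$3$1 * A$4$2 - A$3$2 * A$4$1))"
proof -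
  have f1: "finite {2::4, 3, 4}" "1 \<notin> {2::4, 3, 4}"
    and f2: "finite {3::4, 4}" "2 \<notin> {3::4, 4}"
    and f3: "finite {4::4}" "3 \<notin> {4::4}"
    by auto
  show ?thesis
    unfolding det_def UNIV_4
    unfolding sum_over_permutations_insert[OF f1] sum_over_permutations_insert[OF f2]
      sum_over_permutations_insert[OF f3] permutes_sing
    by (simp add: sign_swap_id permutation_swap_id sign_compose sign_id permutation_compose
        transpose_apply_commute Transposition.transpose_def algebra_simps)
qed

lemma ex_normal_frame_at:
  assumes "spacelike_surface D z" "p \<in> D"
  shows "\<exists>n1 n2. normal_frame_at z p n1 n2"
proof -
  note d = derivative_eq[OF spacelike_differentiable[OF assms]]
  define a b where "a = du z p" and "b = dv z p"
  define e :: "real^4" where "e = vector [0, 0, 0, 1]"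
  define \<delta> where "\<delta> = mink a a * mink b b - (mink a b)\<^sup>2"
  have \<delta>: "\<delta> > 0"
    using spacelike_pos[OF assms] by (simp add: \<delta>_def a_def b_def EE_def FF_def GG_def)
  define t where "t = frechet_derivative z (at p) (tan_coords z p e)"
  define m where "m = e - t"
  have "normal_vector z p m"
    using normal_part_normal[OF assms] by (simp add: m_def t_def normal_part_def)
  then have m: "mink m a = 0" "mink m b = 0"
    by (simp_all add: normal_vector_def a_def b_def)
  have tm: "mink t m = 0"
  proof -
    obtain x y where "t = x *\<^sub>R a + y *\<^sub>R b"
      unfolding t_def a_def b_def using d by (metis surj_pair)
    then show ?thesis
      using m by (simp add: mink_simps mink_commute[of _ m])
  qed
  have tt: "mink t t \<ge> 0"
  proof (cases "tan_coords z p e = 0")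
    case True
    have "t = 0"
      using d[of 0 0] unfolding t_def True by (simp add: zero_prod_def)
    then show ?thesis by (simp add: mink_def)
  next
    case False
    then show ?thesis
      using assms unfolding spacelike_surface_def t_def by (blast intro: less_imp_le)
  qed
  have "mink e e = -1"
    by (simp add: e_def mink_def vector_def)
  moreover have "mink e e = mink m m + 2 * mink t m + mink t t"
    by (simp add: m_def mink_simps mink_commute[of e t])
  ultimately have mm: "mink m m < 0"
    using tm tt by simp
  define n2 where "n2 = (1 / sqrt (- mink m m)) *\<^sub>R m"
  have n2: "mink n2 a = 0" "mink n2 b = 0" "mink n2 n2 = -1"
    using m mm by (simp_all add: n2_def mink_simps field_simps)
  define n :: "real^4" where "n = vector
    [a$2 * (b$3 * n2$4 - b$4 * n2$3) - a$3 * (b$2 * n2$4 - b$4 * n2$2) + a$4 * (b$2 * n2$3 - b$3 * n2$2),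
     - (a$1 * (b$3 * n2$4 - b$4 * n2$3) - a$3 * (b$1 * n2$4 - b$4 * n2$1) + a$4 * (b$1 * n2$3 - b$3 * n2$1)),
     a$1 * (b$2 * n2$4 - b$4 * n2$2) - a$2 * (b$1 * n2$4 - b$4 * n2$1) + a$4 * (b$1 * n2$2 - b$2 * n2$1),
     a$1 * (b$2 * n2$3 - b$3 * n2$2) - a$2 * (b$1 * n2$3 - b$3 * n2$1) + a$3 * (b$1 * n2$2 - b$2 * n2$1)]"
  have nc: "n$1 = a$2 * (b$3 * n2$4 - b$4 * n2$3) - a$3 * (b$2 * n2$4 - b$4 * n2$2) + a$4 * (b$2 * n2$3 - b$3 * n2$2)"
    "n$2 = - (a$1 * (b$3 * n2$4 - b$4 * n2$3) - a$3 * (b$1 * n2$4 - b$4 * n2$1) + a$4 * (b$1 * n2$3 - b$3 * n2$1))"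
    "n$3 = a$1 * (b$2 * n2$4 - b$4 * n2$2) - a$2 * (b$1 * n2$4 - b$4 * n2$1) + a$4 * (b$1 * n2$2 - b$2 * n2$1)"
    "n$4 = a$1 * (b$2 * n2$3 - b$3 * n2$2) - a$2 * (b$1 * n2$3 - b$3 * n2$1) + a$3 * (b$1 * n2$2 - b$2 * n2$1)"
    by (simp_all add: n_def vector_def)
  have n0: "mink n a = 0" "mink n b = 0" "mink n n2 = 0"
    unfolding mink_def nc by algebra+
  have "mink n n = - (mink a a * (mink b b * mink n2 n2 - (mink n2 b)\<^sup>2)
      - mink a b * (mink a b * mink n2 n2 - mink n2 b * mink n2 a)
      + mink n2 a * (mink a b * mink n2 b - mink b b * mink n2 a))"
    unfolding mink_def nc by algebra
  then have nn: "mink n n = \<delta>"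
    unfolding n2 by (simp add: \<delta>_def power2_eq_square)
  define n1 where "n1 = (1 / sqrt \<delta>) *\<^sub>R n"
  have n1: "mink n1 a = 0" "mink n1 b = 0" "mink n1 n2 = 0" "mink n1 n1 = 1"
    using n0 nn \<delta> by (simp_all add: n1_def mink_simps field_simps)
  have "det (vector [a, b, n1, n2] :: real^4^4) = mink n n1"
    unfolding det_4 mink_def nc by (simp add: vector_def) algebra
  also have "\<dots> > 0"
    using nn \<delta> by (simp add: n1_def mink_simps)
  finally have "normal_frame_at z p n1 n2"
    using n1 n2 by (simp add: normal_frame_at_def normal_vector_def a_def b_def)
  then show ?thesis by blast
qed

end

theory Submission
  imports Defs
begin

text \<open>Let \<open>x, y\<close> be the orthonormal tangent frame, \<open>\<sigma>\<close> the second fundamental tensor and \<open>K\<close> the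
  Gauss curvature. The structure and Codazzi equations show that for every spacelike surface
  \<open>\<Delta>G = (4 \<langle>H,H\<rangle> - 2K) G - 2 D\<^sub>xH \<and> y - 2 x \<and> D\<^sub>yH - 2 (\<sigma>(x,x) - \<sigma>(y,y)) \<and> \<sigma>(x,y)\<close>
  (lemmas \<open>laplacian_gauss_map\<close> and, for lightlike \<open>H\<close>, \<open>laplacian_gauss_map_trapped\<close>).

  If \<open>DH = 0\<close>, then the normal curvature annihilates \<open>H\<close>. An infinitesimal isometry of the Lorentzian
  normal plane that annihilates a nonzero lightlike vector is zero, so the normal bundle is flat.
  Up to a factor, the last bivector of the formula is the normal curvature; so only \<open>\<Delta>G = -2K G\<close> remains, and
  \<open>C = 0\<close> will do.

  Conversely let \<open>\<Delta>G = \<phi>(G + C)\<close>. Because \<open>H\<close> is lightlike, \<open>DH\<close> is a multiple of \<open>H\<close>, so, with \<open>l\<close>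
  on the other null line of the normal plane, the multiple can be read off by evaluating the bivector
  \<open>\<Delta>G\<close>, as an alternating form, on the pairs \<open>(x,l)\<close> and \<open>(y,l)\<close>. There \<open>G\<close> contributes nothing, so it
  is enough that \<open>\<phi> C\<close> vanishes on these pairs. This is clear where \<open>\<phi> = 0\<close>. On the open set where
  \<open>\<phi> \<noteq> 0\<close> the formula gives \<open>C(H,x) = C(H,y) = 0\<close>, and \<open>C\<close> is constant, so these equations can be
  differentiated. Freeness of flat points says that the shape operator \<open>A\<^sub>H\<close>, which is symmetric and
  trace-free, does not vanish, and hence is invertible. One differentiation then gives \<open>C(x,y) = 0\<close>
  and \<open>C(H,\<cdot>) = 0\<close>, and a second one \<open>C(x,\<cdot>) = C(y,\<cdot>) = 0\<close> (lemma
  \<open>constant_bivector_annihilates_tangents\<close>). All of this is local, so the domain may be disconnected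
  and \<open>\<phi>\<close> may have zeros.\<close>

section \<open>Calculus of smooth maps\<close>

lemma Ck_on_Suc_imp: "Ck_on (Suc n) f S \<Longrightarrow> Ck_on n f S"
proof (induction n arbitrary: f)
  case 0
  then show ?case
    by (auto intro!: differentiable_imp_continuous_on differentiable_at_imp_differentiable_on)
next
  case (Suc n)
  then show ?case by (metis Ck_on.simps(2))
qed

lemma Ck_on_cong:
  assumes "open S" "\<And>p. p \<in> S \<Longrightarrow> f p = g p" "Ck_on n f S"
  shows "Ck_on n g S"
  using assms(2,3)
proof (induction n arbitrary: f g)
  case 0
  then show ?case using continuous_on_cong by (metis Ck_on.simps(1))
next
  case (Suc n)
  have f: "f differentiable (at p)" if "p \<in> S" for p
    using Suc.prems(2) that by simp
  have d: "g differentiable (at p)" if "p \<in> S" for p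
    using f[OF that] has_derivative_transform_within_open[of f _ p UNIV S g, OF _ assms(1) that]
      Suc.prems(1) unfolding differentiable_def by blast
  have e: "frechet_derivative f (at p) = frechet_derivative g (at p)" if "p \<in> S" for p
    by (rule frechet_derivative_transform_within_open[OF f[OF that] assms(1) that Suc.prems(1)])
  have "Ck_on n (\<lambda>p. frechet_derivative g (at p) a) S" for a
    by (rule Suc.IH[of "\<lambda>p. frechet_derivative f (at p) a"]) (use e Suc.prems(2) in auto)
  then show ?case using d by simp
qed

text \<open>Differentiability classes are closed under the usual operations because the derivative of a
  compound expression is again an expression of the same kind in functions of one class less. This
  rule reduces each closure property to exhibiting that derivative.\<close>

lemma Ck_on_SucI:
  assumes "open S" "\<And>p. p \<in> S \<Longrightarrow> (f has_derivative f' p) (at p)" "\<And>a. Ck_on n (\<lambda>p. f' p a) S"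
  shows "Ck_on (Suc n) f S"
proof -
  have "Ck_on n (\<lambda>p. frechet_derivative f (at p) a) S" for a
    by (rule Ck_on_cong[OF assms(1) _ assms(3)[of a]])
      (simp add: frechet_derivative_at[OF assms(2), symmetric])
  then show ?thesis using assms(2) by (auto intro: differentiableI)
qed

lemma Ck_on_has_derivative:
  "Ck_on (Suc n) f S \<Longrightarrow> p \<in> S \<Longrightarrow> (f has_derivative frechet_derivative f (at p)) (at p)"
  by (simp add: frechet_derivative_works[symmetric])

lemma Ck_on_const: "open S \<Longrightarrow> Ck_on n (\<lambda>p. c) S"
  by (induction n arbitrary: c) simp_all

lemma Ck_on_linear:
  assumes "bounded_linear L" "open S" "Ck_on n f S"
  shows "Ck_on n (\<lambda>p. L (f p)) S"
  using assms(3)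
proof (induction n arbitrary: f)
  case 0
  then show ?case
    by (simp add: bounded_linear.continuous_on[OF assms(1)])
next
  case (Suc n)
  have "Ck_on n (\<lambda>p. L (frechet_derivative f (at p) a)) S" for a
    using Suc by simp
  from Ck_on_SucI[OF assms(2) bounded_linear.has_derivative[OF assms(1)
          Ck_on_has_derivative[OF Suc.prems]] this]
  show ?case .
qed

lemma Ck_on_add:
  assumes "open S" "Ck_on n f S" "Ck_on n g S"
  shows "Ck_on n (\<lambda>p. f p + g p) S"
  using assms(2,3)
proof (induction n arbitrary: f g)
  case 0
  then show ?case by (simp add: continuous_on_add)
next
  case (Suc n)
  have "Ck_on n (\<lambda>p. frechet_derivative f (at p) a + frechet_derivative g (at p) a) S" for a
    using Suc by simp
  from Ck_on_SucI[OF assms(1) has_derivative_add[OF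
          Ck_on_has_derivative[OF Suc.prems(1)] Ck_on_has_derivative[OF Suc.prems(2)]] this]
  show ?case .
qed

lemma Ck_on_bilinear:
  assumes "bounded_bilinear B" "open S" "Ck_on n f S" "Ck_on n g S"
  shows "Ck_on n (\<lambda>p. B (f p) (g p)) S"
  using assms(3,4)
proof (induction n arbitrary: f g)
  case 0
  then show ?case by (simp add: bounded_bilinear.continuous_on[OF assms(1)])
next
  case (Suc n)
  note f = Ck_on_Suc_imp[OF Suc.prems(1)] and g = Ck_on_Suc_imp[OF Suc.prems(2)]
  have "Ck_on n (\<lambda>p. B (f p) (frechet_derivative g (at p) a)
      + B (frechet_derivative f (at p) a) (g p)) S" for a
    using Suc f g by (intro Ck_on_add assms(2)) simp_all
  from Ck_on_SucI[OF assms(2) bounded_bilinear.FDERIV[OF assms(1)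
          Ck_on_has_derivative[OF Suc.prems(1)] Ck_on_has_derivative[OF Suc.prems(2)]] this]
  show ?case .
qed

lemma Ck_on_inverse:
  fixes g :: "'a::real_normed_vector \<Rightarrow> real"
  assumes "open S" "\<And>p. p \<in> S \<Longrightarrow> g p \<noteq> 0" "Ck_on n g S"
  shows "Ck_on n (\<lambda>p. inverse (g p)) S"
  using assms(3)
proof (induction n)
  case 0
  then show ?case using assms(2) by (auto intro: continuous_on_inverse)
next
  case (Suc n)
  note I = Suc.IH[OF Ck_on_Suc_imp[OF Suc.prems]]
  have "Ck_on n (\<lambda>p. - (inverse (g p) * frechet_derivative g (at p) a * inverse (g p))) S" for a
    using Suc.prems I
    by (intro Ck_on_linear[OF bounded_linear_minus[OF bounded_linear_ident]]
        Ck_on_bilinear[OF bounded_bilinear_mult] assms(1)) auto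
  from Ck_on_SucI[OF assms(1) Deriv.has_derivative_inverse[OF assms(2)
          Ck_on_has_derivative[OF Suc.prems]] this]
  show ?case .
qed

text \<open>The derivative of \<open>sqrt g\<close> contains \<open>1 / sqrt g\<close>, which belongs to one class less by the induction
  hypothesis together with closure under inversion.\<close>

lemma Ck_on_sqrt:
  fixes g :: "'a::real_normed_vector \<Rightarrow> real"
  assumes "open S" "\<And>p. p \<in> S \<Longrightarrow> 0 < g p" "Ck_on n g S"
  shows "Ck_on n (\<lambda>p. sqrt (g p)) S"
  using assms(3)
proof (induction n)
  case 0
  then show ?case by (auto intro: continuous_on_real_sqrt)
next
  case (Suc n)
  note I = Suc.IH[OF Ck_on_Suc_imp[OF Suc.prems]]
  have "Ck_on n (\<lambda>p. inverse (sqrt (g p))) S"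
    by (rule Ck_on_inverse[OF assms(1) _ I]) (metis assms(2) less_irrefl real_sqrt_gt_0_iff)
  then have C: "Ck_on n (\<lambda>p. (1/2) * (inverse (sqrt (g p)) * frechet_derivative g (at p) a)) S" for a
    using Suc.prems
    by (intro Ck_on_linear[OF bounded_linear_mult_right] Ck_on_bilinear[OF bounded_bilinear_mult]
        assms(1)) auto
  have "((\<lambda>p. sqrt (g p)) has_derivative
      (\<lambda>a. (1/2) * (inverse (sqrt (g p)) * frechet_derivative g (at p) a))) (at p)" if p: "p \<in> S" for p
  proof -
    have "((\<lambda>x. sqrt x) has_derivative (*) (inverse (sqrt (g p)) / 2)) (at (g p))"
      using DERIV_real_sqrt[OF assms(2)[OF p]] unfolding has_field_derivative_def .
    from has_derivative_compose[OF Ck_on_has_derivative[OF Suc.prems p] this]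
    show ?thesis by (simp add: mult_ac)
  qed
  then show ?case by (rule Ck_on_SucI[OF assms(1) _ C])
qed

lemma smooth_on_cong:
  "smooth_on f S \<Longrightarrow> open S \<Longrightarrow> (\<And>p. p \<in> S \<Longrightarrow> f p = g p) \<Longrightarrow> smooth_on g S"
  unfolding smooth_on_def using Ck_on_cong by blast

lemma smooth_on_differentiable: "smooth_on f S \<Longrightarrow> p \<in> S \<Longrightarrow> f differentiable (at p)"
  unfolding smooth_on_def by (metis Ck_on.simps(2))

lemma smooth_on_continuous: "smooth_on f S \<Longrightarrow> continuous_on S f"
  unfolding smooth_on_def by (metis Ck_on.simps(1))

lemma smooth_on_derivative: "smooth_on f S \<Longrightarrow> smooth_on (\<lambda>p. frechet_derivative f (at p) a) S"
  unfolding smooth_on_def by (metis Ck_on.simps(2))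

lemma smooth_on_const: "open S \<Longrightarrow> smooth_on (\<lambda>p. c) S"
  unfolding smooth_on_def using Ck_on_const by blast

lemma smooth_on_linear:
  "bounded_linear L \<Longrightarrow> open S \<Longrightarrow> smooth_on f S \<Longrightarrow> smooth_on (\<lambda>p. L (f p)) S"
  unfolding smooth_on_def using Ck_on_linear by blast

lemma smooth_on_add:
  "open S \<Longrightarrow> smooth_on f S \<Longrightarrow> smooth_on g S \<Longrightarrow> smooth_on (\<lambda>p. f p + g p) S"
  unfolding smooth_on_def using Ck_on_add by blast

lemma smooth_on_minus: "open S \<Longrightarrow> smooth_on f S \<Longrightarrow> smooth_on (\<lambda>p. - f p) S"
  by (rule smooth_on_linear[OF bounded_linear_minus[OF bounded_linear_ident]])

lemma smooth_on_diff:
  "open S \<Longrightarrow> smooth_on f S \<Longrightarrow> smooth_on g S \<Longrightarrow> smooth_on (\<lambda>p. f p - g p) S"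
  using smooth_on_add[OF _ _ smooth_on_minus, of S f g] by simp

lemma smooth_on_bilinear:
  "bounded_bilinear B \<Longrightarrow> open S \<Longrightarrow> smooth_on f S \<Longrightarrow> smooth_on g S \<Longrightarrow>
    smooth_on (\<lambda>p. B (f p) (g p)) S"
  unfolding smooth_on_def using Ck_on_bilinear by blast

lemma smooth_on_sqrt:
  fixes g :: "'a::real_normed_vector \<Rightarrow> real"
  shows "open S \<Longrightarrow> smooth_on g S \<Longrightarrow> (\<And>p. p \<in> S \<Longrightarrow> 0 < g p) \<Longrightarrow> smooth_on (\<lambda>p. sqrt (g p)) S"
  unfolding smooth_on_def using Ck_on_sqrt by blast

lemma smooth_on_divide:
  fixes g :: "'a::real_normed_vector \<Rightarrow> real"
  assumes "open S" "smooth_on f S" "smooth_on g S" "\<And>p. p \<in> S \<Longrightarrow> g p \<noteq> 0"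
  shows "smooth_on (\<lambda>p. f p / g p) S"
proof -
  have "smooth_on (\<lambda>p. inverse (g p)) S"
    using assms Ck_on_inverse unfolding smooth_on_def by blast
  then show ?thesis
    unfolding divide_inverse
    by (rule smooth_on_bilinear[OF bounded_bilinear_mult assms(1,2)])
qed

section \<open>Symmetry of second derivatives\<close>

text \<open>Two applications of the mean value theorem turn the second difference of \<open>f\<close> over the
  parallelogram with sides \<open>h a\<close> and \<open>h b\<close> into \<open>h\<^sup>2\<close> times a value of one mixed derivative. Exchanging
  \<open>a\<close> and \<open>b\<close> does not change the second difference but gives the other mixed derivative.\<close>

lemma second_difference_mvt:
  fixes f :: "'a::real_normed_vector \<Rightarrow> real"
  assumes f: "Ck_on 2 f S" and h: "0 < h"
    and S: "\<And>s t. 0 \<le> s \<Longrightarrow> s \<le> h \<Longrightarrow> 0 \<le> t \<Longrightarrow> t \<le> h \<Longrightarrow> p + s *\<^sub>R a + t *\<^sub>R b \<in> S"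
  shows "\<exists>s t. 0 < s \<and> s < h \<and> 0 < t \<and> t < h \<and>
    f (p + h *\<^sub>R a + h *\<^sub>R b) - f (p + h *\<^sub>R a) - f (p + h *\<^sub>R b) + f p =
    h\<^sup>2 * frechet_derivative (\<lambda>q. frechet_derivative f (at q) a) (at (p + s *\<^sub>R a + t *\<^sub>R b)) b"
proof -
  define g where "g = (\<lambda>q. frechet_derivative f (at q) a)"
  have line: "((\<lambda>r. k (q + r *\<^sub>R c)) has_real_derivative frechet_derivative k (at (q + s *\<^sub>R c)) c) (at s)"
    if "k differentiable (at (q + s *\<^sub>R c))" for k :: "'a \<Rightarrow> real" and q c s
  proof -
    have "((\<lambda>r. q + r *\<^sub>R c) has_derivative (\<lambda>r. r *\<^sub>R c)) (at s)"
      by (auto intro!: derivative_eq_intros)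
    moreover have "(k has_derivative frechet_derivative k (at (q + s *\<^sub>R c))) (at (q + s *\<^sub>R c))"
      using that by (simp add: frechet_derivative_works[symmetric])
    ultimately have "((\<lambda>r. k (q + r *\<^sub>R c)) has_derivative
        (\<lambda>r. frechet_derivative k (at (q + s *\<^sub>R c)) (r *\<^sub>R c))) (at s)"
      by (rule has_derivative_compose)
    then show ?thesis
      unfolding has_field_derivative_def
      by (simp add: linear_cmul[OF linear_frechet_derivative[OF that]]
        mult.commute[of _ "frechet_derivative _ _ _"])
  qed
  have f1: "f differentiable (at q)" and g1: "g differentiable (at q)" if "q \<in> S" for q
    using f that by (auto simp: numeral_2_eq_2 g_def)
  let ?G = "\<lambda>s. f (p + h *\<^sub>R b + s *\<^sub>R a) - f (p + s *\<^sub>R a)"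
  have "(?G has_real_derivative g (p + h *\<^sub>R b + s *\<^sub>R a) - g (p + s *\<^sub>R a)) (at s)"
    if "0 \<le> s" "s \<le> h" for s
    unfolding g_def using S[OF that, of h] S[OF that, of 0] h
    by (intro DERIV_diff line f1) (auto simp: ac_simps)
  from MVT2[OF h this] obtain s where s: "0 < s" "s < h"
    and 1: "?G h - ?G 0 = h * (g (p + h *\<^sub>R b + s *\<^sub>R a) - g (p + s *\<^sub>R a))"
    by (metis diff_zero)
  let ?K = "\<lambda>t. g (p + s *\<^sub>R a + t *\<^sub>R b)"
  have "(?K has_real_derivative frechet_derivative g (at (p + s *\<^sub>R a + t *\<^sub>R b)) b) (at t)"
    if "0 \<le> t" "t \<le> h" for t
    using S[of s t] s that by (intro line g1) auto
  from MVT2[OF h this] obtain t where t: "0 < t" "t < h"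
    and 2: "?K h - ?K 0 = h * frechet_derivative g (at (p + s *\<^sub>R a + t *\<^sub>R b)) b"
    by (metis diff_zero)
  have "f (p + h *\<^sub>R a + h *\<^sub>R b) - f (p + h *\<^sub>R a) - f (p + h *\<^sub>R b) + f p = ?G h - ?G 0"
    by (simp add: ac_simps)
  also have "\<dots> = h * (?K h - ?K 0)"
    unfolding 1 by (simp add: ac_simps)
  also have "\<dots> = h\<^sup>2 * frechet_derivative g (at (p + s *\<^sub>R a + t *\<^sub>R b)) b"
    unfolding 2 by (simp add: power2_eq_square)
  finally show ?thesis
    using s t unfolding g_def by blast
qed

text \<open>The two mixed derivatives agree at points of arbitrarily small parallelograms at \<open>p\<close>, and they
  are continuous.\<close>

lemma second_derivative_symmetric:
  fixes f :: "'a::real_normed_vector \<Rightarrow> real"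
  assumes f: "Ck_on 2 f S" and "open S" and p: "p \<in> S"
  shows "frechet_derivative (\<lambda>q. frechet_derivative f (at q) a) (at p) b =
    frechet_derivative (\<lambda>q. frechet_derivative f (at q) b) (at p) a"
proof -
  define M where "M = (\<lambda>a b q. frechet_derivative (\<lambda>q. frechet_derivative f (at q) a) (at q) b)"
  have C: "continuous_on S (M a b)" for a b
    using f unfolding M_def by (simp add: numeral_2_eq_2)
  have "dist (M a b p) (M b a p) \<le> e" if e: "e > 0" for e
  proof -
    have "\<exists>\<delta>>0. \<forall>q. dist q p < \<delta> \<longrightarrow> q \<in> S \<and> dist (M a b q) (M a b p) < e/2" for a b
    proof -
      obtain \<delta>1 where "\<delta>1 > 0" "\<forall>q\<in>S. dist q p < \<delta>1 \<longrightarrow> dist (M a b q) (M a b p) < e/2"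
        using C[of a b] p e unfolding continuous_on_iff by (metis half_gt_zero)
      moreover obtain \<delta>2 where "\<delta>2 > 0" "\<forall>q. dist q p < \<delta>2 \<longrightarrow> q \<in> S"
        using \<open>open S\<close> p unfolding open_dist by blast
      ultimately show ?thesis
        by (intro exI[of _ "min \<delta>1 \<delta>2"]) auto
    qed
    then obtain \<delta>1 \<delta>2 where \<delta>: "\<delta>1 > 0" "\<delta>2 > 0"
      and 1: "\<And>q. dist q p < \<delta>1 \<Longrightarrow> q \<in> S \<and> dist (M a b q) (M a b p) < e/2"
      and 2: "\<And>q. dist q p < \<delta>2 \<Longrightarrow> q \<in> S \<and> dist (M b a q) (M b a p) < e/2"
      by meson
    define m where "m = norm a + norm b + 1"
    have m: "m > 0"
      unfolding m_def by (smt (verit) norm_ge_zero)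
    \<comment> \<open>small enough for the whole parallelogram to lie within both distances of \<open>p\<close>\<close>
    define h where "h = min \<delta>1 \<delta>2 / m"
    have h: "h > 0" "h * m = min \<delta>1 \<delta>2"
      using \<delta> m by (auto simp: h_def)
    have near: "dist (p + s *\<^sub>R a + t *\<^sub>R b) p < min \<delta>1 \<delta>2"
      if "0 \<le> s" "s \<le> h" "0 \<le> t" "t \<le> h" for s t
    proof -
      have "dist (p + s *\<^sub>R a + t *\<^sub>R b) p \<le> norm (s *\<^sub>R a) + norm (t *\<^sub>R b)"
        using norm_triangle_ineq[of "s *\<^sub>R a" "t *\<^sub>R b"] by (simp add: dist_norm add.assoc)
      also have "\<dots> \<le> h * norm a + h * norm b"
        using that by (intro add_mono) (auto intro: mult_right_mono)
      also have "\<dots> < h * m"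
        using h(1) by (simp add: m_def algebra_simps)
      finally show ?thesis
        unfolding h .
    qed
    have near': "dist (p + s *\<^sub>R b + t *\<^sub>R a) p < min \<delta>1 \<delta>2"
      if "0 \<le> s" "s \<le> h" "0 \<le> t" "t \<le> h" for s t
      using near[OF that(3,4,1,2)] by (simp add: ac_simps)
    have in_S: "p + s *\<^sub>R a + t *\<^sub>R b \<in> S" and in_S': "p + s *\<^sub>R b + t *\<^sub>R a \<in> S"
      if "0 \<le> s" "s \<le> h" "0 \<le> t" "t \<le> h" for s t
      using 1 near[OF that] near'[OF that] by simp_all
    obtain s t where st: "0 < s" "s < h" "0 < t" "t < h"
      and A: "f (p + h *\<^sub>R a + h *\<^sub>R b) - f (p + h *\<^sub>R a) - f (p + h *\<^sub>R b) + f p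
        = h\<^sup>2 * M a b (p + s *\<^sub>R a + t *\<^sub>R b)"
      using second_difference_mvt[OF f h(1) in_S] unfolding M_def by blast
    obtain s' t' where st': "0 < s'" "s' < h" "0 < t'" "t' < h"
      and B: "f (p + h *\<^sub>R b + h *\<^sub>R a) - f (p + h *\<^sub>R b) - f (p + h *\<^sub>R a) + f p
        = h\<^sup>2 * M b a (p + s' *\<^sub>R b + t' *\<^sub>R a)"
      using second_difference_mvt[OF f h(1) in_S'] unfolding M_def by blast
    have "f (p + h *\<^sub>R b + h *\<^sub>R a) = f (p + h *\<^sub>R a + h *\<^sub>R b)"
      by (simp add: ac_simps)
    then have "h\<^sup>2 * M a b (p + s *\<^sub>R a + t *\<^sub>R b) = h\<^sup>2 * M b a (p + s' *\<^sub>R b + t' *\<^sub>R a)"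
      using A B by argo
    then have "M a b (p + s *\<^sub>R a + t *\<^sub>R b) = M b a (p + s' *\<^sub>R b + t' *\<^sub>R a)"
      using h by simp
    moreover have "dist (M a b (p + s *\<^sub>R a + t *\<^sub>R b)) (M a b p) < e/2"
      using 1 near[of s t] st by simp
    moreover have "dist (M b a (p + s' *\<^sub>R b + t' *\<^sub>R a)) (M b a p) < e/2"
      using 2 near'[of s' t'] st' by simp
    ultimately show ?thesis
      by (smt (verit) dist_commute dist_triangle field_sum_of_halves)
  qed
  then have "dist (M a b p) (M b a p) \<le> 0"
    by (rule field_le_epsilon) simp
  then show ?thesis
    unfolding M_def by simp
qed

lemma second_derivative_symmetric_vec:
  fixes f :: "'a::real_normed_vector \<Rightarrow> real^'n"
  assumes f: "smooth_on f S" and "open S" and p: "p \<in> S"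
  shows "frechet_derivative (\<lambda>q. frechet_derivative f (at q) a) (at p) b =
    frechet_derivative (\<lambda>q. frechet_derivative f (at q) b) (at p) a"
proof -
  have comp: "frechet_derivative (\<lambda>q. g q $ i) (at q) = (\<lambda>a. frechet_derivative g (at q) a $ i)"
    if "smooth_on g S" "q \<in> S" for g :: "'a \<Rightarrow> real^'n" and q i
    using bounded_linear.has_derivative[OF bounded_linear_vec_nth]
      smooth_on_differentiable[OF that] frechet_derivative_at
    by (metis (mono_tags, lifting) frechet_derivative_works)
  have twice: "frechet_derivative (\<lambda>q. frechet_derivative (\<lambda>q. f q $ i) (at q) a) (at p) b =
      frechet_derivative (\<lambda>q. frechet_derivative f (at q) a) (at p) b $ i" for a b i
  proof -
    have "frechet_derivative (\<lambda>q. frechet_derivative (\<lambda>q. f q $ i) (at q) a) (at p) =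
        frechet_derivative (\<lambda>q. frechet_derivative f (at q) a $ i) (at p)"
      using f comp[OF f]
      by (intro frechet_derivative_transform_within_open[OF _ \<open>open S\<close> p]
          smooth_on_differentiable[of _ S] smooth_on_derivative smooth_on_linear[OF bounded_linear_vec_nth]
          assms) auto
    then show ?thesis
      by (simp add: comp[OF smooth_on_derivative[OF f] p])
  qed
  have "Ck_on 2 (\<lambda>q. f q $ i) S" for i
    using smooth_on_linear[OF bounded_linear_vec_nth \<open>open S\<close> f] by (simp add: smooth_on_def)
  from second_derivative_symmetric[OF this \<open>open S\<close> p] show ?thesis
    by (simp add: vec_eq_iff twice)
qed

section \<open>Derivatives along tangent fields\<close>

lemma flatD_bilinear:
  assumes "bounded_bilinear B" "f differentiable (at p)" "g differentiable (at p)"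
  shows "flatD X (\<lambda>q. B (f q) (g q)) p = B (f p) (flatD X g p) + B (flatD X f p) (g p)"
proof -
  note D = bounded_bilinear.FDERIV[OF assms(1) assms(2)[unfolded frechet_derivative_works]
      assms(3)[unfolded frechet_derivative_works]]
  show ?thesis
    unfolding flatD_def frechet_derivative_at[OF D, symmetric] ..
qed

lemma flatD_linear:
  assumes "bounded_linear L" "f differentiable (at p)"
  shows "flatD X (\<lambda>q. L (f q)) p = L (flatD X f p)"
proof -
  note D = bounded_linear.has_derivative[OF assms(1) assms(2)[unfolded frechet_derivative_works]]
  show ?thesis
    unfolding flatD_def frechet_derivative_at[OF D, symmetric] ..
qed

lemma flatD_add:
  assumes "f differentiable (at p)" "g differentiable (at p)"
  shows "flatD X (\<lambda>q. f q + g q) p = flatD X f p + flatD X g p"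
proof -
  note D = has_derivative_add[OF assms[unfolded frechet_derivative_works]]
  show ?thesis
    unfolding flatD_def frechet_derivative_at[OF D, symmetric] ..
qed

lemma flatD_diff:
  assumes "f differentiable (at p)" "g differentiable (at p)"
  shows "flatD X (\<lambda>q. f q - g q) p = flatD X f p - flatD X g p"
proof -
  note D = has_derivative_diff[OF assms[unfolded frechet_derivative_works]]
  show ?thesis
    unfolding flatD_def frechet_derivative_at[OF D, symmetric] ..
qed

lemma flatD_cong:
  assumes "f differentiable (at p)" "open S" "p \<in> S" "\<And>q. q \<in> S \<Longrightarrow> f q = g q"
  shows "flatD X f p = flatD X g p"
  unfolding flatD_def
  by (rule fun_cong[OF frechet_derivative_transform_within_open[OF assms(1-3)]]) (rule assms(4))

lemma flatD_eq_0:
  assumes "open S" "p \<in> S" "\<And>q. q \<in> S \<Longrightarrow> f q = k"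
  shows "flatD X f p = 0"
proof -
  have "flatD X (\<lambda>_. k) p = flatD X f p"
    by (rule flatD_cong[OF differentiable_const assms(1,2)]) (rule assms(3)[symmetric])
  then show ?thesis
    by (simp add: flatD_def)
qed

lemma flatD_coords:
  "f differentiable (at p) \<Longrightarrow> flatD X f p = fst (X p) *\<^sub>R du f p + snd (X p) *\<^sub>R dv f p"
  unfolding flatD_def using derivative_eq[of f p "fst (X p)" "snd (X p)"] by simp

lemma smooth_on_du: "smooth_on f S \<Longrightarrow> smooth_on (du f) S"
  and smooth_on_dv: "smooth_on f S \<Longrightarrow> smooth_on (dv f) S"
  unfolding du_def dv_def flatD_def by (rule smooth_on_derivative, assumption)+

lemma smooth_on_flatD:
  assumes "open S" "smooth_on X S" "smooth_on f S"
  shows "smooth_on (flatD X f) S"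
proof (rule smooth_on_cong)
  show "smooth_on (\<lambda>p. fst (X p) *\<^sub>R du f p + snd (X p) *\<^sub>R dv f p) S"
    using assms by (intro smooth_on_add smooth_on_bilinear[OF bounded_bilinear_scaleR]
        smooth_on_linear[OF bounded_linear_fst] smooth_on_linear[OF bounded_linear_snd]
        smooth_on_du smooth_on_dv)
qed (use assms in \<open>simp_all add: flatD_coords smooth_on_differentiable\<close>)

text \<open>The second derivative along \<open>X\<close> and \<open>Y\<close> splits into the Hessian of \<open>f\<close> in the parameters and
  the contribution of the variation of \<open>Y\<close>. Since the Hessian is symmetric, only the
  latter survives in a commutator.\<close>

lemma flatD_flatD:
  fixes f :: "real \<times> real \<Rightarrow> 'b::real_normed_vector"
  assumes S: "open S" "p \<in> S" and Y: "smooth_on Y S" and f: "smooth_on f S"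
  shows "flatD X (flatD Y f) p =
    frechet_derivative (\<lambda>q. frechet_derivative f (at q) (Y p)) (at p) (X p)
    + frechet_derivative f (at p) (flatD X Y p)"
proof -
  note du = smooth_on_differentiable[OF smooth_on_du[OF f] S(2)]
    and dv = smooth_on_differentiable[OF smooth_on_dv[OF f] S(2)]
    and df = smooth_on_differentiable[OF f]
    and dY = smooth_on_differentiable[OF Y S(2)]
  note F = smooth_on_linear[OF bounded_linear_fst S(1) Y]
    and N = smooth_on_linear[OF bounded_linear_snd S(1) Y]
  have dF: "(\<lambda>q. fst (Y q) *\<^sub>R du f q) differentiable (at p)"
    and dN: "(\<lambda>q. snd (Y q) *\<^sub>R dv f q) differentiable (at p)"
    by (rule smooth_on_differentiable[OF smooth_on_bilinear[OF bounded_bilinear_scaleR S(1)] S(2)],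
        fact, rule smooth_on_du smooth_on_dv, fact)+
  have "flatD X (flatD Y f) p = flatD X (\<lambda>q. fst (Y q) *\<^sub>R du f q + snd (Y q) *\<^sub>R dv f q) p"
    by (rule flatD_cong[OF _ S])
      (simp_all add: smooth_on_differentiable[OF smooth_on_flatD[OF S(1) Y f] S(2)] flatD_coords df)
  also have "\<dots> = (fst (Y p) *\<^sub>R flatD X (du f) p + fst (flatD X Y p) *\<^sub>R du f p)
      + (snd (Y p) *\<^sub>R flatD X (dv f) p + snd (flatD X Y p) *\<^sub>R dv f p)"
    unfolding flatD_add[OF dF dN]
    by (simp add: flatD_bilinear[OF bounded_bilinear_scaleR smooth_on_differentiable[OF F S(2)] du]
        flatD_bilinear[OF bounded_bilinear_scaleR smooth_on_differentiable[OF N S(2)] dv]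
        flatD_linear[OF bounded_linear_fst dY] flatD_linear[OF bounded_linear_snd dY])
  also have "\<dots> = (fst (Y p) *\<^sub>R flatD X (du f) p + snd (Y p) *\<^sub>R flatD X (dv f) p)
      + frechet_derivative f (at p) (flatD X Y p)"
    using derivative_eq[OF df[OF S(2)], of "fst (flatD X Y p)" "snd (flatD X Y p)"] by simp
  also have "fst (Y p) *\<^sub>R flatD X (du f) p + snd (Y p) *\<^sub>R flatD X (dv f) p
      = flatD X (\<lambda>q. fst (Y p) *\<^sub>R du f q + snd (Y p) *\<^sub>R dv f q) p"
    using du dv
    by (simp add: flatD_add flatD_linear[OF bounded_linear_scaleR_right] differentiable_scaleR)
  also have "\<dots> = flatD X (\<lambda>q. frechet_derivative f (at q) (Y p)) p"
    by (rule flatD_cong[OF _ S])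
      (use du dv in \<open>simp_all add: differentiable_scaleR
        derivative_eq[OF df, of _ "fst (Y p)" "snd (Y p)", simplified]\<close>)
  also have "\<dots> = frechet_derivative (\<lambda>q. frechet_derivative f (at q) (Y p)) (at p) (X p)"
    by (simp add: flatD_def)
  finally show ?thesis .
qed

text \<open>The bracket of \<open>X\<close> and \<open>Y\<close>, in coordinates \<open>X(Y) - Y(X)\<close>, is the tangent field that differentiates
  as the commutator does.\<close>

lemma flatD_commutator:
  fixes f :: "real \<times> real \<Rightarrow> real^'n"
  assumes "open S" "p \<in> S" "smooth_on X S" "smooth_on Y S" "smooth_on f S"
  shows "flatD X (flatD Y f) p - flatD Y (flatD X f) p =
    frechet_derivative f (at p) (flatD X Y p - flatD Y X p)"
  unfolding flatD_flatD[OF assms(1,2,4,5)] flatD_flatD[OF assms(1,2,3,5)]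
    second_derivative_symmetric_vec[OF assms(5,1,2), of "X p" "Y p"]
    linear_diff[OF linear_frechet_derivative[OF smooth_on_differentiable[OF assms(5,2)]]]
  by simp

section \<open>The scalar product and bivectors\<close>

lemma bounded_bilinear_mink: "bounded_bilinear mink"
  unfolding bilinear_conv_bounded_bilinear[symmetric] bilinear_def
  by (auto intro!: linearI simp: mink_simps)

lemma mink_0_minus [simp]:
  "mink 0 x = 0" "mink x 0 = 0" "mink (- x) y = - mink x y" "mink x (- y) = - mink x y"
  by (simp_all add: mink_def)

lemma mink_nondegenerate:
  assumes "\<And>w. mink v w = 0"
  shows "v = 0"
proof -
  have "v $ i = 0" for i
    using assms[of "axis 1 1"] assms[of "axis 2 1"] assms[of "axis 3 1"] assms[of "axis 4 1"]
      exhaust_4[of i] by (auto simp: mink_def axis_def)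
  then show ?thesis
    by (simp add: vec_eq_iff)
qed

lemma wedge_simps:
  "wedge (u + v) w = wedge u w + wedge v w" "wedge w (u + v) = wedge w u + wedge w v"
  "wedge (u - v) w = wedge u w - wedge v w" "wedge w (u - v) = wedge w u - wedge w v"
  "wedge (- u) w = - wedge u w" "wedge w (- u) = - wedge w u"
  "wedge (k *\<^sub>R u) w = k *\<^sub>R wedge u w" "wedge w (k *\<^sub>R u) = k *\<^sub>R wedge w u"
  "wedge u u = 0" "wedge 0 w = 0" "wedge w 0 = 0"
  by (simp_all add: wedge_def vec_eq_iff algebra_simps)

lemma bounded_bilinear_wedge: "bounded_bilinear wedge"
  unfolding bilinear_conv_bounded_bilinear[symmetric] bilinear_def
  by (auto intro!: linearI simp: wedge_simps)

text \<open>The alternating form obtained from a bivector by lowering both indices with the Minkowski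
  metric. It allows the components of a bivector to be tested against pairs of vectors.\<close>

definition biform :: "real^4^4 \<Rightarrow> real^4 \<Rightarrow> real^4 \<Rightarrow> real" where
  "biform C u v = mink u (\<chi> i. mink (C $ i) v)"

lemma biform_simps:
  "biform C (u + v) w = biform C u w + biform C v w"
  "biform C w (u + v) = biform C w u + biform C w v"
  "biform C (u - v) w = biform C u w - biform C v w"
  "biform C w (u - v) = biform C w u - biform C w v"
  "biform C (- u) w = - biform C u w" "biform C w (- u) = - biform C w u"
  "biform C (k *\<^sub>R u) w = k * biform C u w" "biform C w (k *\<^sub>R u) = k * biform C w u"
  by (simp_all add: biform_def mink_def algebra_simps)

lemma biform_tensor_simps:
  "biform (A + B) u v = biform A u v + biform B u v"
  "biform (A - B) u v = biform A u v - biform B u v"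
  "biform (k *\<^sub>R A) u v = k * biform A u v"
  "biform (- A) u v = - biform A u v"
  by (simp_all add: biform_def mink_def algebra_simps)

lemma biform_wedge: "biform (wedge a b) u v = mink a u * mink b v - mink b u * mink a v"
  by (simp add: biform_def mink_def wedge_def algebra_simps)

lemma biform_antisym:
  assumes "C \<in> bivectors"
  shows "biform C u v = - biform C v u" "biform C u u = 0"
proof -
  have "C $ i $ j = - C $ j $ i" for i j
  proof -
    have "C $ i $ j = transpose C $ j $ i"
      by (simp add: transpose_def)
    also have "\<dots> = (- C) $ j $ i"
      using assms unfolding bivectors_def by simp
    finally show ?thesis
      by simp
  qed
  from this[of 1 1] this[of 2 2] this[of 3 3] this[of 4 4] this[of 2 1] this[of 3 1] this[of 4 1]
    this[of 3 2] this[of 4 2] this[of 4 3]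
  show *: "biform C u v = - biform C v u" for u v
    unfolding biform_def mink_def by (simp add: algebra_simps)
  show "biform C u u = 0"
    using *[of u u] by simp
qed

lemma bounded_bilinear_biform: "bounded_bilinear (biform C)"
  unfolding bilinear_conv_bounded_bilinear[symmetric] bilinear_def
  by (auto intro!: linearI simp: biform_simps)

section \<open>Adapted orthonormal frames\<close>

lemma smooth_on_Pair:
  assumes "open S" "smooth_on f S" "smooth_on g S"
  shows "smooth_on (\<lambda>p. (f p :: real, g p :: real)) S"
proof -
  have "smooth_on (\<lambda>p. f p *\<^sub>R (1::real, 0::real) + g p *\<^sub>R (0, 1)) S"
    using assms by (intro smooth_on_add smooth_on_linear[OF bounded_linear_scaleR_left])
  then show ?thesis
    by simp
qed

locale spacelike =
  fixes D :: "(real \<times> real) set" and z :: param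
  assumes spacelike: "spacelike_surface D z"
begin

abbreviation d1 :: "(real \<times> real \<Rightarrow> 'b::real_normed_vector) \<Rightarrow> real \<times> real \<Rightarrow> 'b" where
  "d1 \<equiv> flatD (frame1 z)"

abbreviation d2 :: "(real \<times> real \<Rightarrow> 'b::real_normed_vector) \<Rightarrow> real \<times> real \<Rightarrow> 'b" where
  "d2 \<equiv> flatD (frame2 z)"

definition x :: "real \<times> real \<Rightarrow> real^4" where "x = d1 z"

definition y :: "real \<times> real \<Rightarrow> real^4" where "y = d2 z"

text \<open>The connection form \<open>\<langle>\<nabla>x, y\<rangle>\<close> of the frame, evaluated on \<open>x\<close> and on \<open>y\<close>.\<close>

definition \<theta>1 :: "real \<times> real \<Rightarrow> real" where "\<theta>1 p = mink (d1 x p) (y p)"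

definition \<theta>2 :: "real \<times> real \<Rightarrow> real" where "\<theta>2 p = mink (d2 x p) (y p)"

text \<open>The components \<open>\<sigma>(x,x)\<close>, \<open>\<sigma>(x,y)\<close> and \<open>\<sigma>(y,y)\<close> of the second fundamental tensor, written without
  projections: the derivative of a unit vector of the frame has only one tangential component, and
  that one is \<open>\<theta>1\<close> or \<open>\<theta>2\<close> up to sign.\<close>

definition sff11 :: "real \<times> real \<Rightarrow> real^4" where "sff11 p = d1 x p - \<theta>1 p *\<^sub>R y p"

definition sff12 :: "real \<times> real \<Rightarrow> real^4" where "sff12 p = d1 y p + \<theta>1 p *\<^sub>R x p"

definition sff22 :: "real \<times> real \<Rightarrow> real^4" where "sff22 p = d2 y p + \<theta>2 p *\<^sub>R x p"

abbreviation H :: "real \<times> real \<Rightarrow> real^4" where "H \<equiv> mean_curvature z"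

lemma D: "open D" and smooth_z: "smooth_on z D"
  using spacelike by (auto simp: spacelike_surface_def)

lemmas smooth_bil = smooth_on_bilinear[OF _ D]

lemma smooth_frame1: "smooth_on (frame1 z) D" and smooth_frame2: "smooth_on (frame2 z) D"
proof -
  note u = smooth_on_du[OF smooth_z] and v = smooth_on_dv[OF smooth_z]
  have E: "smooth_on (EE z) D" and F: "smooth_on (FF z) D" and G: "smooth_on (GG z) D"
    using smooth_bil[OF bounded_bilinear_mink u u] smooth_bil[OF bounded_bilinear_mink u v]
      smooth_bil[OF bounded_bilinear_mink v v] unfolding EE_def FF_def GG_def by blast+
  note pos = spacelike_pos[OF spacelike]
  have sE: "smooth_on (\<lambda>p. sqrt (EE z p)) D"
    by (rule smooth_on_sqrt[OF D E pos(1)])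
  have "smooth_on (\<lambda>p. sqrt (EE z p * GG z p - FF z p * FF z p)) D"
    using pos by (intro smooth_on_sqrt smooth_on_diff smooth_bil[OF bounded_bilinear_mult] D E F G)
      (simp add: power2_eq_square)
  then have W: "smooth_on (WW z) D"
    unfolding WW_def power2_eq_square .
  have nz: "sqrt (EE z p) \<noteq> 0" "WW z p \<noteq> 0" if "p \<in> D" for p
    using pos[OF that] by (simp_all add: WW_def)
  show "smooth_on (frame1 z) D"
    unfolding frame1_def[abs_def] using nz
    by (intro smooth_on_Pair smooth_on_divide smooth_on_const sE D) auto
  show "smooth_on (frame2 z) D"
    unfolding frame2_def[abs_def] using nz
    by (intro smooth_on_Pair smooth_on_divide smooth_on_minus smooth_bil[OF bounded_bilinear_mult]
        F W sE D) auto
qed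

lemma smooth_d1: "smooth_on f D \<Longrightarrow> smooth_on (d1 f) D"
  by (rule smooth_on_flatD[OF D smooth_frame1])

lemma smooth_d2: "smooth_on f D \<Longrightarrow> smooth_on (d2 f) D"
  by (rule smooth_on_flatD[OF D smooth_frame2])

lemma smooth_mink: "smooth_on f D \<Longrightarrow> smooth_on g D \<Longrightarrow> smooth_on (\<lambda>p. mink (f p) (g p)) D"
  by (rule smooth_bil[OF bounded_bilinear_mink])

lemma smooth_scaleR: "smooth_on f D \<Longrightarrow> smooth_on g D \<Longrightarrow> smooth_on (\<lambda>p. f p *\<^sub>R g p) D"
  by (rule smooth_bil[OF bounded_bilinear_scaleR])

lemma smooth_wedge: "smooth_on f D \<Longrightarrow> smooth_on g D \<Longrightarrow> smooth_on (\<lambda>p. wedge (f p) (g p)) D"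
  by (rule smooth_bil[OF bounded_bilinear_wedge])

lemma smooth_x: "smooth_on x D" and smooth_y: "smooth_on y D"
  unfolding x_def y_def by (rule smooth_d1 smooth_d2, rule smooth_z)+

lemma smooth_\<theta>1: "smooth_on \<theta>1 D" and smooth_\<theta>2: "smooth_on \<theta>2 D"
  unfolding \<theta>1_def[abs_def] \<theta>2_def[abs_def]
  by (rule smooth_mink, rule smooth_d1 smooth_d2, rule smooth_x, rule smooth_y)+

lemma smooth_sff11: "smooth_on sff11 D"
  unfolding sff11_def[abs_def]
  by (intro smooth_on_diff D smooth_d1 smooth_scaleR smooth_x smooth_y smooth_\<theta>1)

lemma smooth_sff12: "smooth_on sff12 D"
  unfolding sff12_def[abs_def]
  by (intro smooth_on_add D smooth_d1 smooth_scaleR smooth_x smooth_y smooth_\<theta>1)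

lemma smooth_sff22: "smooth_on sff22 D"
  unfolding sff22_def[abs_def]
  by (intro smooth_on_add D smooth_d2 smooth_scaleR smooth_x smooth_y smooth_\<theta>2)

lemmas diff = smooth_on_differentiable

lemma flatD_mink:
  assumes "p \<in> D" "smooth_on f D" "smooth_on g D"
  shows "flatD X (\<lambda>q. mink (f q) (g q)) p = mink (f p) (flatD X g p) + mink (flatD X f p) (g p)"
  by (rule flatD_bilinear[OF bounded_bilinear_mink diff[OF assms(2,1)] diff[OF assms(3,1)]])

lemma flatD_scaleR:
  assumes "p \<in> D" "smooth_on f D" "smooth_on g D"
  shows "flatD X (\<lambda>q. f q *\<^sub>R g q) p = f p *\<^sub>R flatD X g p + flatD X f p *\<^sub>R g p"
  by (rule flatD_bilinear[OF bounded_bilinear_scaleR diff[OF assms(2,1)] diff[OF assms(3,1)]])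

lemma flatD_wedge:
  assumes "p \<in> D" "smooth_on f D" "smooth_on g D"
  shows "flatD X (\<lambda>q. wedge (f q) (g q)) p = wedge (f p) (flatD X g p) + wedge (flatD X f p) (g p)"
  by (rule flatD_bilinear[OF bounded_bilinear_wedge diff[OF assms(2,1)] diff[OF assms(3,1)]])

lemma flatD_mink_const:
  assumes "p \<in> D" "smooth_on f D" "smooth_on g D" "\<And>q. q \<in> D \<Longrightarrow> mink (f q) (g q) = k"
  shows "mink (flatD X f p) (g p) = - mink (f p) (flatD X g p)"
  using flatD_mink[OF assms(1-3), of X]
    flatD_eq_0[of D p "\<lambda>q. mink (f q) (g q)" k X, OF D assms(1,4)] by simp

lemma orthonormal:
  assumes "p \<in> D"
  shows "mink (x p) (x p) = 1" "mink (x p) (y p) = 0" "mink (y p) (x p) = 0" "mink (y p) (y p) = 1"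
  using frame_orthonormal[OF spacelike assms]
  by (simp_all add: x_def y_def push_def mink_commute)

lemma frame_spans:
  assumes "p \<in> D"
  shows "\<exists>k m. w = k *\<^sub>R frame1 z p + m *\<^sub>R frame2 z p"
proof -
  have pos: "sqrt (EE z p) > 0" "WW z p > 0"
    using spacelike_pos[OF spacelike assms] by (simp_all add: WW_def)
  define m where "m = snd w * WW z p / sqrt (EE z p)"
  define k where "k = sqrt (EE z p) * (fst w + m * FF z p / (sqrt (EE z p) * WW z p))"
  have "w = k *\<^sub>R frame1 z p + m *\<^sub>R frame2 z p"
    using pos by (simp add: prod_eq_iff frame1_def frame2_def k_def m_def)
  then show ?thesis
    by blast
qed

text \<open>The vector fields of the frame span every parameter direction, so all derivatives are combinations
  of \<open>d1\<close> and \<open>d2\<close>; the coefficients are read off from the image of the direction under \<open>z\<close>.\<close>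

lemma derivative_combination:
  assumes "f differentiable (at p)"
  shows "frechet_derivative f (at p) (k *\<^sub>R frame1 z p + m *\<^sub>R frame2 z p) =
    k *\<^sub>R d1 f p + m *\<^sub>R d2 f p"
  unfolding flatD_def
  by (simp add: linear_add[OF linear_frechet_derivative[OF assms]]
      linear_cmul[OF linear_frechet_derivative[OF assms]])

lemma derivative_frame:
  assumes p: "p \<in> D" and f: "f differentiable (at p)"
  shows "frechet_derivative f (at p) w =
    mink (frechet_derivative z (at p) w) (x p) *\<^sub>R d1 f p
    + mink (frechet_derivative z (at p) w) (y p) *\<^sub>R d2 f p"
proof -
  obtain k m where w: "w = k *\<^sub>R frame1 z p + m *\<^sub>R frame2 z p"
    using frame_spans[OF p] by blast
  have "frechet_derivative z (at p) w = k *\<^sub>R x p + m *\<^sub>R y p"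
    unfolding w x_def y_def by (rule derivative_combination[OF diff[OF smooth_z p]])
  then have "mink (frechet_derivative z (at p) w) (x p) = k"
    "mink (frechet_derivative z (at p) w) (y p) = m"
    by (simp_all add: mink_simps orthonormal[OF p])
  then show ?thesis
    unfolding w derivative_combination[OF f] by simp
qed

lemma derivative_tan_coords:
  assumes p: "p \<in> D" and f: "f differentiable (at p)"
  shows "frechet_derivative f (at p) (tan_coords z p v) =
    mink v (x p) *\<^sub>R d1 f p + mink v (y p) *\<^sub>R d2 f p"
proof -
  have n: "normal_vector z p (v - frechet_derivative z (at p) (tan_coords z p v))"
    using normal_part_normal[OF spacelike p] unfolding normal_part_def .
  have "mink (frechet_derivative z (at p) (tan_coords z p v)) (x p) = mink v (x p)"
    "mink (frechet_derivative z (at p) (tan_coords z p v)) (y p) = mink v (y p)"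
    using n unfolding x_def y_def flatD_coords[OF diff[OF smooth_z p]]
    by (simp_all add: normal_vector_def mink_simps)
  then show ?thesis
    by (simp add: derivative_frame[OF p f])
qed

lemma normal_part_frame:
  assumes "p \<in> D"
  shows "normal_part z p v = v - mink v (x p) *\<^sub>R x p - mink v (y p) *\<^sub>R y p"
  unfolding normal_part_def derivative_tan_coords[OF assms diff[OF smooth_z assms]] x_def[symmetric]
    y_def[symmetric] by simp

lemma normal_vector_frame:
  assumes p: "p \<in> D"
  shows "normal_vector z p v \<longleftrightarrow> mink v (x p) = 0 \<and> mink v (y p) = 0"
proof
  show "normal_vector z p v \<Longrightarrow> mink v (x p) = 0 \<and> mink v (y p) = 0"
    unfolding x_def y_def flatD_coords[OF diff[OF smooth_z p]]
    by (simp add: normal_vector_def mink_simps)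
next
  assume "mink v (x p) = 0 \<and> mink v (y p) = 0"
  then have "normal_part z p v = v"
    by (simp add: normal_part_frame[OF p])
  then show "normal_vector z p v"
    using normal_part_normal[OF spacelike p, of v] by simp
qed

section \<open>Structure equations\<close>

lemma structure_d1x: "d1 x p = \<theta>1 p *\<^sub>R y p + sff11 p"
  and structure_d1y: "d1 y p = sff12 p - \<theta>1 p *\<^sub>R x p"
  and structure_d2y: "d2 y p = sff22 p - \<theta>2 p *\<^sub>R x p"
  by (simp_all add: sff11_def sff12_def sff22_def)

lemma frame_derivatives:
  assumes p: "p \<in> D"
  shows "mink (flatD X x p) (x p) = 0" "mink (flatD X y p) (y p) = 0"
    "mink (flatD X y p) (x p) = - mink (flatD X x p) (y p)"
  using flatD_mink_const[OF p smooth_x smooth_x orthonormal(1), of X]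
    flatD_mink_const[OF p smooth_y smooth_y orthonormal(4), of X]
    flatD_mink_const[OF p smooth_y smooth_x orthonormal(3), of X]
  by (simp_all add: mink_commute)

lemma normal_sff:
  assumes p: "p \<in> D"
  shows "mink (sff11 p) (x p) = 0" "mink (sff11 p) (y p) = 0" "mink (sff12 p) (x p) = 0" "mink (sff12 p) (y p) = 0"
    "mink (sff22 p) (x p) = 0" "mink (sff22 p) (y p) = 0"
  by (simp_all add: sff11_def sff12_def sff22_def mink_simps orthonormal[OF p] frame_derivatives[OF p]
      \<theta>1_def \<theta>2_def)

text \<open>The bracket \<open>[x,y] = \<nabla>\<^sub>xy - \<nabla>\<^sub>yx\<close> of the frame fields. Its components are found by applying the
  commutator to \<open>z\<close> itself and taking scalar products with \<open>x\<close> and \<open>y\<close>.\<close>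

lemma commutator:
  fixes f :: "real \<times> real \<Rightarrow> real^4"
  assumes p: "p \<in> D" and f: "smooth_on f D"
  shows "d1 (d2 f) p - d2 (d1 f) p = - \<theta>1 p *\<^sub>R d1 f p - \<theta>2 p *\<^sub>R d2 f p"
proof -
  let ?w = "flatD (frame1 z) (frame2 z) p - flatD (frame2 z) (frame1 z) p"
  have *: "d1 (d2 g) p - d2 (d1 g) p = frechet_derivative g (at p) ?w"
    if "smooth_on g D" for g :: "real \<times> real \<Rightarrow> real^4"
    by (rule flatD_commutator[OF D p smooth_frame1 smooth_frame2 that])
  have v: "frechet_derivative z (at p) ?w = d1 y p - d2 x p"
    unfolding x_def y_def by (rule *[OF smooth_z, symmetric])
  have "mink (d1 y p - d2 x p) (x p) = - \<theta>1 p" "mink (d1 y p - d2 x p) (y p) = - \<theta>2 p"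
    by (simp_all add: mink_simps frame_derivatives[OF p] \<theta>1_def \<theta>2_def)
  then show ?thesis
    unfolding *[OF f] derivative_frame[OF p diff[OF f p]] v by simp
qed

text \<open>Symmetry of the second fundamental tensor: the bracket of \<open>x\<close> and \<open>y\<close> is tangential, so the normal
  parts of \<open>d2 x\<close> and \<open>d1 y\<close> coincide.\<close>

lemma structure_d2x:
  assumes p: "p \<in> D"
  shows "d2 x p = \<theta>2 p *\<^sub>R y p + sff12 p"
  using commutator[OF p smooth_z] unfolding x_def[symmetric] y_def[symmetric] structure_d1y
  by (simp add: algebra_simps)

lemma H_eq:
  assumes p: "p \<in> D"
  shows "H p = (1/2) *\<^sub>R (sff11 p + sff22 p)"
proof -
  have "sff z (frame1 z) (frame1 z) p = sff11 p" "sff z (frame2 z) (frame2 z) p = sff22 p"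
    unfolding sff_def push_def x_def[symmetric] y_def[symmetric] normal_part_frame[OF p]
      structure_d1x structure_d2y
    by (simp_all add: mink_simps orthonormal[OF p] normal_sff[OF p])
  then show ?thesis
    by (simp add: mean_curvature_def)
qed

lemma smooth_H: "smooth_on H D"
proof -
  have "smooth_on (\<lambda>p. (1/2) *\<^sub>R (sff11 p + sff22 p)) D"
    by (intro smooth_on_linear[OF bounded_linear_scaleR_right] smooth_on_add D smooth_sff11 smooth_sff22)
  then show ?thesis
    by (rule smooth_on_cong[OF _ D]) (simp add: H_eq)
qed

lemma normal_H:
  assumes p: "p \<in> D"
  shows "mink (H p) (x p) = 0" "mink (H p) (y p) = 0"
  by (simp_all add: H_eq[OF p] mink_simps normal_sff[OF p])

lemma flatD_H:
  assumes p: "p \<in> D"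
  shows "2 *\<^sub>R flatD X H p = flatD X sff11 p + flatD X sff22 p"
proof -
  have s: "smooth_on (\<lambda>p. sff11 p + sff22 p) D"
    by (intro smooth_on_add D smooth_sff11 smooth_sff22)
  have "flatD X H p = flatD X (\<lambda>p. (1/2) *\<^sub>R (sff11 p + sff22 p)) p"
    by (rule flatD_cong[OF diff[OF smooth_H p] D p H_eq])
  also have "\<dots> = (1/2) *\<^sub>R (flatD X sff11 p + flatD X sff22 p)"
    unfolding flatD_linear[OF bounded_linear_scaleR_right diff[OF s p]]
      flatD_add[OF diff[OF smooth_sff11 p] diff[OF smooth_sff22 p]] ..
  finally show ?thesis
    by simp
qed

text \<open>The Gauss curvature, expressed by the exterior derivative of the connection form.\<close>

definition K :: "real \<times> real \<Rightarrow> real" where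
  "K p = d2 \<theta>1 p - d1 \<theta>2 p - (\<theta>1 p)\<^sup>2 - (\<theta>2 p)\<^sup>2"

lemma smooth_K: "smooth_on K D"
  unfolding K_def[abs_def] power2_eq_square
  by (intro smooth_on_diff D smooth_d1 smooth_d2 smooth_bil[OF bounded_bilinear_mult]
      smooth_\<theta>1 smooth_\<theta>2)

text \<open>The commutator applied to \<open>x\<close> and to \<open>y\<close>. The normal parts of the two identities are the Codazzi
  equations; the terms with \<open>K\<close> come from the derivatives of the connection form. Keeping the
  tangential parts avoids projecting the derivatives of the second fundamental tensor to the normal plane.\<close>

lemma codazzi:
  assumes p: "p \<in> D"
  shows "d1 sff12 p = d2 sff11 p + \<theta>1 p *\<^sub>R (sff22 p - sff11 p) - (2 * \<theta>2 p) *\<^sub>R sff12 p + K p *\<^sub>R y p"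
    and "d2 sff12 p = d1 sff22 p + (2 * \<theta>1 p) *\<^sub>R sff12 p + \<theta>2 p *\<^sub>R (sff22 p - sff11 p) + K p *\<^sub>R x p"
proof -
  note sc = smooth_scaleR
  note fs = flatD_scaleR[OF p]
  have x12: "d1 (d2 x) p = (\<theta>2 p *\<^sub>R d1 y p + d1 \<theta>2 p *\<^sub>R y p) + d1 sff12 p"
  proof -
    have "d1 (d2 x) p = d1 (\<lambda>p. \<theta>2 p *\<^sub>R y p + sff12 p) p"
      by (rule flatD_cong[OF diff[OF smooth_d2[OF smooth_x] p] D p structure_d2x])
    then show ?thesis
      by (simp add: flatD_add diff[OF sc[OF smooth_\<theta>2 smooth_y] p] diff[OF smooth_sff12 p]
          fs[OF smooth_\<theta>2 smooth_y])
  qed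
  have x21: "d2 (d1 x) p = (\<theta>1 p *\<^sub>R d2 y p + d2 \<theta>1 p *\<^sub>R y p) + d2 sff11 p"
    unfolding structure_d1x[abs_def]
    by (simp add: flatD_add diff[OF sc[OF smooth_\<theta>1 smooth_y] p] diff[OF smooth_sff11 p]
          fs[OF smooth_\<theta>1 smooth_y])
  have y12: "d1 (d2 y) p = d1 sff22 p - (\<theta>2 p *\<^sub>R d1 x p + d1 \<theta>2 p *\<^sub>R x p)"
    unfolding structure_d2y[abs_def]
    by (simp add: flatD_diff diff[OF sc[OF smooth_\<theta>2 smooth_x] p] diff[OF smooth_sff22 p]
          fs[OF smooth_\<theta>2 smooth_x])
  have y21: "d2 (d1 y) p = d2 sff12 p - (\<theta>1 p *\<^sub>R d2 x p + d2 \<theta>1 p *\<^sub>R x p)"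
    unfolding structure_d1y[abs_def]
    by (simp add: flatD_diff diff[OF sc[OF smooth_\<theta>1 smooth_x] p] diff[OF smooth_sff12 p]
          fs[OF smooth_\<theta>1 smooth_x])
  show "d1 sff12 p = d2 sff11 p + \<theta>1 p *\<^sub>R (sff22 p - sff11 p) - (2 * \<theta>2 p) *\<^sub>R sff12 p + K p *\<^sub>R y p"
    using commutator[OF p smooth_x]
    unfolding x12 x21 structure_d1x structure_d1y structure_d2y structure_d2x[OF p] K_def
    by (simp add: vec_eq_iff algebra_simps power2_eq_square)
  show "d2 sff12 p = d1 sff22 p + (2 * \<theta>1 p) *\<^sub>R sff12 p + \<theta>2 p *\<^sub>R (sff22 p - sff11 p) + K p *\<^sub>R x p"
    using commutator[OF p smooth_y]
    unfolding y12 y21 structure_d1x structure_d1y structure_d2y structure_d2x[OF p] K_def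
    by (simp add: vec_eq_iff algebra_simps power2_eq_square)
qed

section \<open>The Laplacian of the Gauss map\<close>

lemma laplacian_frame:
  assumes p: "p \<in> D" and f: "f differentiable (at p)"
  shows "laplacian z f p = - (d1 (d1 f) p + d2 (d2 f) p - \<theta>1 p *\<^sub>R d2 f p + \<theta>2 p *\<^sub>R d1 f p)"
proof -
  have "flatD (levi_civita z (frame1 z) (frame1 z)) f p
      = frechet_derivative f (at p) (tan_coords z p (d1 x p))"
    "flatD (levi_civita z (frame2 z) (frame2 z)) f p
      = frechet_derivative f (at p) (tan_coords z p (d2 y p))"
    by (simp_all add: flatD_def[of "levi_civita z X X" for X] levi_civita_def push_def x_def y_def)
  then show ?thesis
    by (simp add: laplacian_def derivative_tan_coords[OF p f] frame_derivatives[OF p]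
        \<theta>1_def[symmetric] \<theta>2_def[symmetric])
qed

text \<open>In the sum of the second derivatives of \<open>x \<and> y\<close>, the Codazzi equations replace \<open>d2 sff12\<close> by \<open>d1 sff22\<close>
  in front of \<open>y\<close>, and \<open>d1 sff12\<close> by \<open>d2 sff11\<close> behind \<open>x\<close>. Together with \<open>d1 sff11\<close> and \<open>d2 sff22\<close> they make up
  the derivatives of \<open>2H\<close>; all terms with \<open>\<theta>1\<close> and \<open>\<theta>2\<close> cancel.\<close>

lemma laplacian_gauss_map:
  assumes p: "p \<in> D"
  shows "laplacian z (gauss_map z) p =
    - (wedge (2 *\<^sub>R d1 H p + K p *\<^sub>R x p) (y p) + wedge (x p) (2 *\<^sub>R d2 H p + K p *\<^sub>R y p)
       + 2 *\<^sub>R wedge (sff11 p - sff22 p) (sff12 p))"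
proof -
  have G: "gauss_map z = (\<lambda>p. wedge (x p) (y p))"
    by (simp add: fun_eq_iff gauss_map_def push_def x_def y_def)
  note sG = smooth_wedge[OF smooth_x smooth_y]
  let ?G = "\<lambda>p. wedge (x p) (y p)"
  have 1: "d1 ?G q = wedge (sff11 q) (y q) + wedge (x q) (sff12 q)" if "q \<in> D" for q
    unfolding flatD_wedge[OF that smooth_x smooth_y] structure_d1x structure_d1y
    by (simp add: wedge_simps)
  have 2: "d2 ?G q = wedge (sff12 q) (y q) + wedge (x q) (sff22 q)" if "q \<in> D" for q
    unfolding flatD_wedge[OF that smooth_x smooth_y] structure_d2x[OF that] structure_d2y
    by (simp add: wedge_simps)
  have cong_d1: "d1 (d1 ?G) p = d1 (\<lambda>q. wedge (sff11 q) (y q) + wedge (x q) (sff12 q)) p"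
    by (rule flatD_cong[OF diff[OF smooth_d1[OF sG] p] D p 1])
  have cong_d2: "d2 (d2 ?G) p = d2 (\<lambda>q. wedge (sff12 q) (y q) + wedge (x q) (sff22 q)) p"
    by (rule flatD_cong[OF diff[OF smooth_d2[OF sG] p] D p 2])
  have 11: "d1 (d1 ?G) p = (wedge (sff11 p) (d1 y p) + wedge (d1 sff11 p) (y p))
      + (wedge (x p) (d1 sff12 p) + wedge (d1 x p) (sff12 p))"
    unfolding cong_d1 flatD_add[OF diff[OF smooth_wedge[OF smooth_sff11 smooth_y] p]
        diff[OF smooth_wedge[OF smooth_x smooth_sff12] p]]
      flatD_wedge[OF p smooth_sff11 smooth_y] flatD_wedge[OF p smooth_x smooth_sff12] ..
  have 22: "d2 (d2 ?G) p = (wedge (sff12 p) (d2 y p) + wedge (d2 sff12 p) (y p))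
      + (wedge (x p) (d2 sff22 p) + wedge (d2 x p) (sff22 p))"
    unfolding cong_d2 flatD_add[OF diff[OF smooth_wedge[OF smooth_sff12 smooth_y] p]
        diff[OF smooth_wedge[OF smooth_x smooth_sff22] p]]
      flatD_wedge[OF p smooth_sff12 smooth_y] flatD_wedge[OF p smooth_x smooth_sff22] ..
  show ?thesis
    unfolding G laplacian_frame[OF p diff[OF sG p]] 11 22 1[OF p] 2[OF p] flatD_H[OF p] codazzi[OF p]
      structure_d1x structure_d1y structure_d2y structure_d2x[OF p]
    by (simp add: vec_eq_iff wedge_def algebra_simps)
qed

section \<open>The normal plane\<close>

text \<open>The difference of the two sides is orthogonal to \<open>z\<^sub>u, z\<^sub>v, n1, n2\<close>, which are linearly independent.\<close>

lemma normal_expansion: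
  assumes p: "p \<in> D" and f: "normal_frame_at z p n1 n2" and n: "normal_vector z p n"
  shows "n = mink n n1 *\<^sub>R n1 - mink n n2 *\<^sub>R n2"
proof -
  have f': "normal_vector z p n1" "normal_vector z p n2" "mink n1 n1 = 1" "mink n2 n2 = -1"
    "mink n1 n2 = 0" "mink n2 n1 = 0"
    using f by (simp_all add: normal_frame_at_def mink_commute)
  define w where "w = n - mink n n1 *\<^sub>R n1 + mink n n2 *\<^sub>R n2"
  have w: "mink w (du z p) = 0" "mink w (dv z p) = 0" "mink w n1 = 0" "mink w n2 = 0"
    using f' n by (simp_all add: w_def normal_vector_def mink_simps)
  define A :: "real^4^4" where "A = vector [du z p, dv z p, n1, n2]"
  define w' :: "real^4" where "w' = vector [w $ 1, w $ 2, w $ 3, - w $ 4]"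
  have "A *v w' = 0"
    using w by (simp add: vec_eq_iff forall_4 matrix_vector_mult_def sum_4 A_def w'_def mink_def
        vector_def mult.commute)
  moreover have "invertible A"
    using f by (simp add: invertible_det_nz A_def normal_frame_at_def)
  ultimately have "w' = 0"
    by (metis matrix_left_invertible_ker invertible_left_inverse)
  then have "w = 0"
    by (simp add: vec_eq_iff forall_4 w'_def vector_def)
  then show ?thesis
    by (simp add: w_def algebra_simps)
qed

text \<open>In the basis \<open>h, l\<close> of null vectors, membership in the line of \<open>h\<close> is the single equation
  \<open>mink n h = 0\<close>. If \<open>h = r n1 - s n2\<close>, then \<open>l\<close> lies on the other null line, spanned by \<open>r n1 + s n2\<close>.\<close>

lemma conjugate_null_vector:
  assumes p: "p \<in> D" and h: "normal_vector z p h" "lightlike h"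
  obtains l where "normal_vector z p l" "mink h l = -1"
    "\<And>n. normal_vector z p n \<Longrightarrow> n = - mink n l *\<^sub>R h - mink n h *\<^sub>R l"
proof -
  obtain n1 n2 where f: "normal_frame_at z p n1 n2"
    using ex_normal_frame_at[OF spacelike p] by blast
  have f': "normal_vector z p n1" "normal_vector z p n2" "mink n1 n1 = 1" "mink n2 n2 = -1"
    "mink n1 n2 = 0" "mink n2 n1 = 0"
    using f by (simp_all add: normal_frame_at_def mink_commute)
  define r s where "r = mink h n1" and "s = mink h n2"
  have h_eq: "h = r *\<^sub>R n1 - s *\<^sub>R n2"
    unfolding r_def s_def by (rule normal_expansion[OF p f h(1)])
  have "mink h h = r\<^sup>2 - s\<^sup>2"
    by (subst (1 2) h_eq) (simp add: mink_simps f' power2_eq_square)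
  then have rs: "s\<^sup>2 = r\<^sup>2"
    using h(2) by (simp add: lightlike_def)
  have r: "r \<noteq> 0"
    using h(2) rs h_eq by (auto simp: lightlike_def)
  \<comment> \<open>scaled so that the scalar product of \<open>h\<close> and \<open>l\<close> is \<open>-1\<close>\<close>
  define \<kappa> where "\<kappa> = - 1 / (2 * r\<^sup>2)"
  have \<kappa>: "\<kappa> * r\<^sup>2 = - 1/2" "\<kappa> * s\<^sup>2 = - 1/2"
    using r rs by (simp_all add: \<kappa>_def)
  define l where "l = \<kappa> *\<^sub>R (r *\<^sub>R n1 + s *\<^sub>R n2)"
  show ?thesis
  proof (rule that[of l])
    show "normal_vector z p l"
      using f' by (simp add: l_def normal_vector_def mink_simps)
    have "mink h l = \<kappa> * r\<^sup>2 + \<kappa> * s\<^sup>2"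
      unfolding h_eq l_def mink_simps f' by (simp add: power2_eq_square algebra_simps)
    then show "mink h l = -1"
      unfolding \<kappa> by simp
    fix n assume n: "normal_vector z p n"
    define t u where "t = mink n n1" and "u = mink n n2"
    have n_eq: "n = t *\<^sub>R n1 - u *\<^sub>R n2"
      unfolding t_def u_def by (rule normal_expansion[OF p f n])
    have 1: "mink n h = t * r - u * s"
      unfolding n_eq h_eq mink_simps f' by simp
    have 2: "mink n l = \<kappa> * (t * r + u * s)"
      unfolding n_eq l_def mink_simps f' by simp
    have "- mink n l *\<^sub>R h - mink n h *\<^sub>R l =
        (- 2 * t * (\<kappa> * r\<^sup>2)) *\<^sub>R n1 + (2 * u * (\<kappa> * s\<^sup>2)) *\<^sub>R n2"
      unfolding 1 2 unfolding l_def h_eq by (simp add: vec_eq_iff power2_eq_square algebra_simps)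
    then show "n = - mink n l *\<^sub>R h - mink n h *\<^sub>R l"
      unfolding \<kappa> by (simp add: n_eq)
  qed
qed

lemma normal_nondegenerate:
  assumes p: "p \<in> D" and m: "normal_vector z p m"
    and n: "\<And>n. normal_vector z p n \<Longrightarrow> mink m n = 0"
  shows "m = 0"
proof (rule mink_nondegenerate)
  fix w
  show "mink m w = 0"
    using n[OF normal_part_normal[OF spacelike p, of w]] m
    by (simp add: normal_part_frame[OF p] mink_simps normal_vector_frame[OF p])
qed

lemma normal_sff_H:
  assumes "p \<in> D"
  shows "normal_vector z p (sff11 p)" "normal_vector z p (sff12 p)" "normal_vector z p (sff22 p)"
    "normal_vector z p (H p)"
  by (simp_all add: normal_vector_frame[OF assms] normal_sff[OF assms] normal_H[OF assms])

definition D1H :: "real \<times> real \<Rightarrow> real^4" where "D1H p = normal_part z p (d1 H p)"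

definition D2H :: "real \<times> real \<Rightarrow> real^4" where "D2H p = normal_part z p (d2 H p)"

lemma normal_DH:
  assumes "p \<in> D"
  shows "normal_vector z p (D1H p)" "normal_vector z p (D2H p)"
  unfolding D1H_def D2H_def by (rule normal_part_normal[OF spacelike assms])+

text \<open>The normal covariant derivative is linear in the direction, and the frame spans all directions.\<close>

lemma parallel_iff: "parallel_mean_curvature D z \<longleftrightarrow> (\<forall>p\<in>D. D1H p = 0 \<and> D2H p = 0)"
proof
  assume "parallel_mean_curvature D z"
  then show "\<forall>p\<in>D. D1H p = 0 \<and> D2H p = 0"
    by (auto simp: parallel_mean_curvature_def normal_connection_def D1H_def D2H_def)
next
  assume *: "\<forall>p\<in>D. D1H p = 0 \<and> D2H p = 0"
  have "normal_connection z X H p = 0" if p: "p \<in> D" for X p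
  proof -
    obtain k m where w: "X p = k *\<^sub>R frame1 z p + m *\<^sub>R frame2 z p"
      using frame_spans[OF p] by blast
    have "normal_connection z X H p = k *\<^sub>R D1H p + m *\<^sub>R D2H p"
      unfolding normal_connection_def flatD_def[of X] w derivative_combination[OF diff[OF smooth_H p]]
        D1H_def D2H_def normal_part_frame[OF p]
      by (simp add: mink_simps algebra_simps)
    then show ?thesis
      using * p by simp
  qed
  then show "parallel_mean_curvature D z"
    by (simp add: parallel_mean_curvature_def)
qed

lemma flatD_H_tangent:
  assumes p: "p \<in> D"
  shows "mink (d1 H p) (x p) = - mink (sff11 p) (H p)" "mink (d1 H p) (y p) = - mink (sff12 p) (H p)"
    "mink (d2 H p) (x p) = - mink (sff12 p) (H p)" "mink (d2 H p) (y p) = - mink (sff22 p) (H p)"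
proof -
  have *: "mink (flatD X H p) (x p) = - mink (H p) (flatD X x p)"
    "mink (flatD X H p) (y p) = - mink (H p) (flatD X y p)" for X
    by (rule flatD_mink_const[OF p smooth_H smooth_x normal_H(1)], assumption,
        rule flatD_mink_const[OF p smooth_H smooth_y normal_H(2)], assumption)
  show "mink (d1 H p) (x p) = - mink (sff11 p) (H p)" "mink (d1 H p) (y p) = - mink (sff12 p) (H p)"
    "mink (d2 H p) (x p) = - mink (sff12 p) (H p)" "mink (d2 H p) (y p) = - mink (sff22 p) (H p)"
    unfolding * structure_d1x structure_d1y structure_d2y structure_d2x[OF p]
    by (simp_all add: mink_simps normal_H[OF p] mink_commute[of _ "H p"])
qed

end

locale trapped = spacelike +
  assumes lightlike_H: "p \<in> D \<Longrightarrow> lightlike (mean_curvature z p)"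
begin

text \<open>The matrix of the shape operator \<open>A\<^sub>H\<close> in the frame \<open>x, y\<close> has rows \<open>(h1, h2)\<close> and \<open>(h2, -h1)\<close>: its
  trace is \<open>2 \<langle>H,H\<rangle> = 0\<close>.\<close>

definition h1 :: "real \<times> real \<Rightarrow> real" where "h1 p = mink (sff11 p) (H p)"

definition h2 :: "real \<times> real \<Rightarrow> real" where "h2 p = mink (sff12 p) (H p)"

lemma mink_H: "p \<in> D \<Longrightarrow> mink (H p) (H p) = 0"
  using lightlike_H by (simp add: lightlike_def)

lemma mink_sff22_H:
  assumes "p \<in> D"
  shows "mink (sff22 p) (H p) = - h1 p"
proof -
  have "mink ((1/2) *\<^sub>R (sff11 p + sff22 p)) (H p) = 0"
    using mink_H[OF assms] H_eq[OF assms] by simp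
  then show ?thesis
    by (simp add: mink_simps h1_def)
qed

lemma weingarten_H:
  assumes p: "p \<in> D"
  shows "d1 H p = D1H p - h1 p *\<^sub>R x p - h2 p *\<^sub>R y p"
    "d2 H p = D2H p - h2 p *\<^sub>R x p + h1 p *\<^sub>R y p"
  by (simp_all add: D1H_def D2H_def normal_part_frame[OF p] flatD_H_tangent[OF p] mink_sff22_H[OF p]
      h1_def h2_def)

lemma mink_DH_H:
  assumes p: "p \<in> D"
  shows "mink (D1H p) (H p) = 0" "mink (D2H p) (H p) = 0"
proof -
  have "mink (flatD X H p) (H p) = 0" for X
    using flatD_mink_const[OF p smooth_H smooth_H mink_H, of X]
    by (simp add: mink_commute[of "H p"])
  then show "mink (D1H p) (H p) = 0" "mink (D2H p) (H p) = 0"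
    by (simp_all add: D1H_def D2H_def normal_part_frame[OF p] mink_simps normal_H[OF p]
        mink_commute[of _ "H p"])
qed

lemma laplacian_gauss_map_trapped:
  assumes p: "p \<in> D"
  shows "laplacian z (gauss_map z) p = (- 2 * K p) *\<^sub>R gauss_map z p
    - 2 *\<^sub>R (wedge (D1H p) (y p) + wedge (x p) (D2H p) + wedge (sff11 p - sff22 p) (sff12 p))"
  unfolding laplacian_gauss_map[OF p] weingarten_H[OF p] gauss_map_def push_def
    x_def[symmetric] y_def[symmetric]
  by (simp add: vec_eq_iff wedge_def algebra_simps)

text \<open>If \<open>A\<^sub>H\<close> vanishes at \<open>p\<close>, then the derivatives of \<open>H\<close> at \<open>p\<close> are normal. Differentiating
  \<open>\<langle>H, z\<^sub>u\<rangle> = \<langle>H, z\<^sub>v\<rangle> = 0\<close> shows that all second derivatives of \<open>z\<close> are orthogonal to \<open>H\<close>. Hence their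
  normal components have a common ratio, so that the minors \<open>L, M, N\<close> vanish.\<close>

lemma shape_operator_H_nonzero:
  assumes p: "p \<in> D" and flat: "\<not> flat_point z p"
  shows "h1 p \<noteq> 0 \<or> h2 p \<noteq> 0"
proof (rule ccontr)
  assume "\<not> ?thesis"
  then have h: "h1 p = 0" "h2 p = 0"
    by auto
  have n: "normal_vector z p (flatD X H p)" for X
  proof -
    obtain k m where w: "X p = k *\<^sub>R frame1 z p + m *\<^sub>R frame2 z p"
      using frame_spans[OF p] by blast
    have "flatD X H p = k *\<^sub>R D1H p + m *\<^sub>R D2H p"
      unfolding flatD_def[of X] w derivative_combination[OF diff[OF smooth_H p]] weingarten_H[OF p] h
      by simp
    then show ?thesis
      using normal_DH[OF p] by (simp add: normal_vector_def mink_simps)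
  qed
  have uv: "mink (H q) (du z q) = 0" "mink (H q) (dv z q) = 0" if "q \<in> D" for q
    using normal_sff_H(4)[OF that] by (simp_all add: normal_vector_def)
  have hu: "mink (H p) (flatD X (du z) p) = 0" and hv: "mink (H p) (flatD X (dv z) p) = 0" for X
    using n[of X] flatD_mink_const[OF p smooth_H smooth_on_du[OF smooth_z] uv(1), of X]
      flatD_mink_const[OF p smooth_H smooth_on_dv[OF smooth_z] uv(2), of X]
    by (simp_all add: normal_vector_def)
  obtain n1 n2 where f: "normal_frame_at z p n1 n2"
    using ex_normal_frame_at[OF spacelike p] by blast
  define r s where "r = mink (H p) n1" and "s = mink (H p) n2"
  have H: "H p = r *\<^sub>R n1 - s *\<^sub>R n2"
    unfolding r_def s_def by (rule normal_expansion[OF p f normal_sff_H(4)[OF p]])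
  have rs: "r \<noteq> 0 \<or> s \<noteq> 0"
    using H lightlike_H[OF p] by (auto simp: lightlike_def)
  have ratio: "r * mink v n1 = s * mink v n2" if "mink (H p) v = 0" for v
    using that unfolding H by (simp add: mink_simps mink_commute)
  have minor: "mink v n1 * mink w n2 - mink w n1 * mink v n2 = 0"
    if "mink (H p) v = 0" "mink (H p) w = 0" for v w
    using ratio[OF that(1)] ratio[OF that(2)] rs by algebra
  have "flat_point z p"
    unfolding flat_point_def LL_def MM_def NN_def
    by (intro exI[of _ n1] exI[of _ n2])
      (simp add: f minor hu hv du_def[of "du z"] dv_def[of "du z"] dv_def[of "dv z"])
  then show False
    using flat by blast
qed

section \<open>From parallel mean curvature to the Gauss map\<close>

text \<open>The Ricci equation for \<open>H\<close>: the commutator applied to \<open>H\<close>, whose derivatives are tangential, says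
  that \<open>(\<sigma>(x,x) - \<sigma>(y,y)) \<and> \<sigma>(x,y)\<close>, contracted with \<open>H\<close>, is zero. A bivector of the normal plane is
  determined by this contraction, so it vanishes and the Laplacian is \<open>-2K G\<close>.\<close>

lemma parallel_imp_pointwise_1_type:
  assumes par: "\<And>p. p \<in> D \<Longrightarrow> D1H p = 0 \<and> D2H p = 0"
  shows "pointwise_1_type_gauss_map D z"
proof -
  have flat_normal_bundle: "wedge (sff11 p - sff22 p) (sff12 p) = 0" if p: "p \<in> D" for p
  proof -
    have s1: "smooth_on h1 D" and s2: "smooth_on h2 D"
      unfolding h1_def[abs_def] h2_def[abs_def]
      by (intro smooth_mink smooth_sff11 smooth_sff12 smooth_H)+
    note sc = smooth_scaleR
    have "d1 (d2 H) p = d1 (\<lambda>q. h1 q *\<^sub>R y q - h2 q *\<^sub>R x q) p"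
      by (rule flatD_cong[OF diff[OF smooth_d2[OF smooth_H] p] D p])
        (simp add: weingarten_H par)
    also have "\<dots> = (h1 p *\<^sub>R d1 y p + d1 h1 p *\<^sub>R y p) - (h2 p *\<^sub>R d1 x p + d1 h2 p *\<^sub>R x p)"
      unfolding flatD_diff[OF diff[OF sc[OF s1 smooth_y] p] diff[OF sc[OF s2 smooth_x] p]]
        flatD_scaleR[OF p s1 smooth_y] flatD_scaleR[OF p s2 smooth_x] ..
    finally have 12: "d1 (d2 H) p = \<dots>" .
    have "d2 (d1 H) p = d2 (\<lambda>q. (- h1 q) *\<^sub>R x q - h2 q *\<^sub>R y q) p"
      by (rule flatD_cong[OF diff[OF smooth_d1[OF smooth_H] p] D p])
        (simp add: weingarten_H par)
    also have "\<dots> = (- h1 p *\<^sub>R d2 x p + d2 (\<lambda>q. - h1 q) p *\<^sub>R x p)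
        - (h2 p *\<^sub>R d2 y p + d2 h2 p *\<^sub>R y p)"
      unfolding flatD_diff[OF diff[OF sc[OF smooth_on_minus[OF D s1] smooth_x] p]
          diff[OF sc[OF s2 smooth_y] p]]
        flatD_scaleR[OF p smooth_on_minus[OF D s1] smooth_x] flatD_scaleR[OF p s2 smooth_y] ..
    finally have 21: "d2 (d1 H) p = \<dots>" .
    have n: "h2 p * mink (sff11 p - sff22 p) n = 2 * h1 p * mink (sff12 p) n" if n: "normal_vector z p n" for n
    proof -
      have xy: "mink (x p) n = 0" "mink (y p) n = 0"
        using n normal_vector_frame[OF p] by (simp_all add: mink_commute)
      have "mink (d1 (d2 H) p - d2 (d1 H) p) n = 0"
        unfolding commutator[OF p smooth_H] weingarten_H[OF p]
        using par[OF p] xy by (simp add: mink_simps)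
      then show ?thesis
        unfolding 12 21 structure_d1x structure_d1y structure_d2y structure_d2x[OF p]
          mink_simps mink_0_minus xy
        by (simp add: algebra_simps)
    qed
    note N = normal_sff_H[OF p]
    \<comment> \<open>either one factor of the wedge product is a multiple of the other, or both are orthogonal to
      \<open>H\<close> and therefore multiples of it\<close>
    consider "h2 p \<noteq> 0" | "h2 p = 0" "h1 p \<noteq> 0" | "h2 p = 0" "h1 p = 0"
      by blast
    then show ?thesis
    proof cases
      case 1
      have "(sff11 p - sff22 p) - (2 * h1 p / h2 p) *\<^sub>R sff12 p = 0"
      proof (rule normal_nondegenerate[OF p])
        show "normal_vector z p (sff11 p - sff22 p - (2 * h1 p / h2 p) *\<^sub>R sff12 p)"
          using N by (simp add: normal_vector_def mink_simps)
      qed (use n 1 in \<open>simp add: mink_simps field_simps\<close>)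
      then have "sff11 p - sff22 p = (2 * h1 p / h2 p) *\<^sub>R sff12 p"
        by simp
      then show ?thesis
        by (simp add: wedge_simps)
    next
      case 2
      then have "sff12 p = 0"
        using n by (intro normal_nondegenerate[OF p N(2)]) simp
      then show ?thesis
        by (simp add: wedge_simps)
    next
      case 3
      obtain l where l: "\<And>n. normal_vector z p n \<Longrightarrow> n = - mink n l *\<^sub>R H p - mink n (H p) *\<^sub>R l"
        using conjugate_null_vector[OF p N(4) lightlike_H[OF p]] by metis
      have "normal_vector z p (sff11 p - sff22 p)"
        using N by (simp add: normal_vector_def mink_simps)
      moreover have "mink (sff11 p - sff22 p) (H p) = 0" "mink (sff12 p) (H p) = 0"
        using 3 mink_sff22_H[OF p] by (simp_all add: h1_def h2_def mink_simps)
      ultimately have "sff11 p - sff22 p = - mink (sff11 p - sff22 p) l *\<^sub>R H p" "sff12 p = - mink (sff12 p) l *\<^sub>R H p"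
        using l[of "sff11 p - sff22 p"] l[OF N(2)] by simp_all
      then obtain r s where "sff11 p - sff22 p = r *\<^sub>R H p" "sff12 p = s *\<^sub>R H p"
        by blast
      then show ?thesis
        by (simp add: wedge_simps)
    qed
  qed
  have "smooth_on (\<lambda>p. - 2 * K p) D"
    by (rule smooth_on_linear[OF bounded_linear_mult_right D smooth_K])
  moreover have "(0 :: real^4^4) \<in> bivectors"
    by (simp add: bivectors_def vec_eq_iff transpose_def)
  moreover have "\<forall>p\<in>D. laplacian z (gauss_map z) p = (- 2 * K p) *\<^sub>R (gauss_map z p + 0)"
    by (simp add: laplacian_gauss_map_trapped par flat_normal_bundle wedge_simps(10,11))
  ultimately show ?thesis
    unfolding pointwise_1_type_gauss_map_def by blast
qed

section \<open>From the Gauss map to parallel mean curvature\<close>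

lemma gauss_map_eq: "gauss_map z p = wedge (x p) (y p)"
  by (simp add: gauss_map_def push_def x_def y_def)

text \<open>On \<open>(H,x)\<close> and \<open>(H,y)\<close> every term vanishes because \<open>DH\<close> is normal and orthogonal to \<open>H\<close>; on \<open>(x,l)\<close> and \<open>(y,l)\<close>
  only the terms with \<open>DH\<close> survive.\<close>

lemma biform_laplacian:
  assumes p: "p \<in> D" and l: "normal_vector z p l"
  defines "L \<equiv> biform (laplacian z (gauss_map z) p)"
  shows "L (H p) (x p) = 0" "L (H p) (y p) = 0"
    "L (x p) l = - 2 * mink (D2H p) l" "L (y p) l = 2 * mink (D1H p) l"
  using l normal_DH[OF p] unfolding L_def laplacian_gauss_map_trapped[OF p] gauss_map_eq
  by (simp_all add: biform_tensor_simps biform_wedge mink_simps orthonormal[OF p] normal_sff[OF p]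
      normal_H[OF p] mink_DH_H[OF p] normal_vector_frame[OF p]
      mink_commute[of "x p" "H p"] mink_commute[of "y p" "H p"]
      mink_commute[of "x p" l] mink_commute[of "y p" l])

lemma biform_gauss_map:
  assumes p: "p \<in> D" and l: "normal_vector z p l"
  shows "biform (gauss_map z p) v l = 0" "biform (gauss_map z p) l v = 0"
  using l unfolding gauss_map_eq
  by (simp_all add: biform_wedge normal_vector_frame[OF p] mink_commute[of _ l])

text \<open>Differentiating \<open>C(H,x) = C(H,y) = 0\<close> along \<open>x\<close> yields two linear equations for \<open>C(x,y)\<close> and \<open>C(H,l)\<close>,
  with determinant \<open>h1\<^sup>2 + h2\<^sup>2 \<noteq> 0\<close> up to sign; hence \<open>C(H,\<cdot>) = 0\<close> on \<open>S\<close>. The derivatives of \<open>H\<close> are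
  \<open>-A\<^sub>H\<close> of the direction plus a multiple of \<open>H\<close>, so differentiating once more yields \<open>C(A\<^sub>Hx,\<cdot>) = 0\<close> and
  \<open>C(A\<^sub>Hy,\<cdot>) = 0\<close>, again a system with determinant \<open>h1\<^sup>2 + h2\<^sup>2\<close> up to sign.\<close>

lemma constant_bivector_annihilates_tangents:
  assumes C: "C \<in> bivectors" and S: "open S" "S \<subseteq> D"
    and flat: "\<And>q. q \<in> S \<Longrightarrow> \<not> flat_point z q"
    and CH: "\<And>q. q \<in> S \<Longrightarrow> biform C (H q) (x q) = 0 \<and> biform C (H q) (y q) = 0"
    and p: "p \<in> S"
  shows "biform C (x p) w = 0" "biform C (y p) w = 0"
proof -
  have H0: "biform C (H q) w = 0" if q: "q \<in> S" for q w
  proof -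
    have qD: "q \<in> D"
      using q S by blast
    note N = normal_sff_H[OF qD]
    obtain l where l: "normal_vector z q l"
      "\<And>n. normal_vector z q n \<Longrightarrow> n = - mink n l *\<^sub>R H q - mink n (H q) *\<^sub>R l"
      using conjugate_null_vector[OF qD N(4) lightlike_H[OF qD]] by metis
    define k m where "k = biform C (x q) (y q)" and "m = biform C (H q) l"
    have Hn: "biform C (H q) n = - mink n (H q) * m" if "normal_vector z q n" for n
      by (subst l(2)[OF that]) (simp add: biform_simps biform_antisym(2)[OF C] m_def)
    have DH: "D1H q = - mink (D1H q) l *\<^sub>R H q"
      using l(2)[OF normal_DH(1)[OF qD]] mink_DH_H[OF qD] by simp
    have CD: "biform C (D1H q) (x q) = 0" "biform C (D1H q) (y q) = 0"
      by (subst DH, simp add: biform_simps CH[OF q])+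
    have yx: "biform C (y q) (x q) = - k"
      using biform_antisym(1)[OF C, of "y q" "x q"] by (simp add: k_def)
    have "0 = d1 (\<lambda>q. biform C (H q) (x q)) q"
      by (rule flatD_eq_0[OF S(1) q, symmetric]) (simp add: CH)
    also have "\<dots> = biform C (H q) (d1 x q) + biform C (d1 H q) (x q)"
      by (rule flatD_bilinear[OF bounded_bilinear_biform diff[OF smooth_H qD] diff[OF smooth_x qD]])
    also have "\<dots> = - h1 q * m + h2 q * k"
      unfolding structure_d1x weingarten_H[OF qD]
      by (simp add: biform_simps CH[OF q] CD biform_antisym(2)[OF C] Hn[OF N(1)] yx h1_def)
    finally have 1: "h2 q * k = h1 q * m"
      by simp
    have "0 = d1 (\<lambda>q. biform C (H q) (y q)) q"
      by (rule flatD_eq_0[OF S(1) q, symmetric]) (simp add: CH)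
    also have "\<dots> = biform C (H q) (d1 y q) + biform C (d1 H q) (y q)"
      by (rule flatD_bilinear[OF bounded_bilinear_biform diff[OF smooth_H qD] diff[OF smooth_y qD]])
    also have "\<dots> = - h2 q * m - h1 q * k"
      unfolding structure_d1y weingarten_H[OF qD]
      by (simp add: biform_simps CH[OF q] CD biform_antisym(2)[OF C] Hn[OF N(2)] k_def h2_def)
    finally have 2: "h2 q * m + h1 q * k = 0"
      by simp
    have "((h1 q)\<^sup>2 + (h2 q)\<^sup>2) * m = 0"
      using 1 2 by algebra
    then have "m = 0"
      using shape_operator_H_nonzero[OF qD flat[OF q]] by (auto simp add: sum_power2_eq_zero_iff)
    have "w = mink w (x q) *\<^sub>R x q + mink w (y q) *\<^sub>R y q + normal_part z q w"
      by (simp add: normal_part_frame[OF qD])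
    then have "biform C (H q) w = biform C (H q) (mink w (x q) *\<^sub>R x q + mink w (y q) *\<^sub>R y q
        + normal_part z q w)"
      by simp
    then show ?thesis
      using Hn[OF normal_part_normal[OF spacelike qD]] \<open>m = 0\<close>
      by (simp add: biform_simps CH[OF q])
  qed
  have pD: "p \<in> D"
    using p S by blast
  obtain l where l: "\<And>n. normal_vector z p n \<Longrightarrow> n = - mink n l *\<^sub>R H p - mink n (H p) *\<^sub>R l"
    using conjugate_null_vector[OF pD normal_sff_H(4)[OF pD] lightlike_H[OF pD]] by metis
  have DH: "D1H p = - mink (D1H p) l *\<^sub>R H p" "D2H p = - mink (D2H p) l *\<^sub>R H p"
    using l[OF normal_DH(1)[OF pD]] l[OF normal_DH(2)[OF pD]] mink_DH_H[OF pD] by simp_all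
  have CD: "biform C (D1H p) w = 0" "biform C (D2H p) w = 0"
    by (subst DH, simp add: biform_simps H0[OF p])+
  have "biform C (flatD X H p) w = 0" for X
  proof -
    have "biform C (flatD X H p) w = flatD X (\<lambda>q. biform C (H q) w) p"
      by (rule flatD_linear[OF bounded_bilinear.bounded_linear_left[OF bounded_bilinear_biform]
            diff[OF smooth_H pD], symmetric])
    also have "\<dots> = 0"
      by (rule flatD_eq_0[OF S(1) p H0])
    finally show ?thesis .
  qed
  from this[of "frame1 z"] this[of "frame2 z"]
  have 1: "h1 p * biform C (x p) w + h2 p * biform C (y p) w = 0"
    and 2: "h1 p * biform C (y p) w = h2 p * biform C (x p) w"
    unfolding weingarten_H[OF pD] by (simp_all add: biform_simps CD)
  have h: "(h1 p)\<^sup>2 + (h2 p)\<^sup>2 \<noteq> 0"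
    using shape_operator_H_nonzero[OF pD flat[OF p]] by (simp add: sum_power2_eq_zero_iff)
  have "((h1 p)\<^sup>2 + (h2 p)\<^sup>2) * biform C (x p) w = 0" "((h1 p)\<^sup>2 + (h2 p)\<^sup>2) * biform C (y p) w = 0"
    using 1 2 by algebra+
  then show "biform C (x p) w = 0" "biform C (y p) w = 0"
    using h by auto
qed

text \<open>The derivative \<open>DH\<close> is a multiple of \<open>H\<close> and vanishes once its scalar product with \<open>l\<close> does. That
  product is an evaluation of \<open>\<phi> (G + C)\<close>, zero for trivial reasons where \<open>\<phi> = 0\<close> and by the preceding
  lemma elsewhere.\<close>

lemma pointwise_1_type_imp_parallel:
  assumes flat: "\<And>p. p \<in> D \<Longrightarrow> \<not> flat_point z p"
    and \<phi>: "smooth_on \<phi> D" and C: "C \<in> bivectors"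
    and eq: "\<And>p. p \<in> D \<Longrightarrow> laplacian z (gauss_map z) p = \<phi> p *\<^sub>R (gauss_map z p + C)"
    and p: "p \<in> D"
  shows "D1H p = 0" "D2H p = 0"
proof -
  define S where "S = D \<inter> \<phi> -` (- {0})"
  have S: "open S" "S \<subseteq> D"
    unfolding S_def using continuous_open_preimage[OF smooth_on_continuous[OF \<phi>] D] by auto
  have CH: "biform C (H q) (x q) = 0 \<and> biform C (H q) (y q) = 0" if q: "q \<in> S" for q
  proof -
    have qD: "q \<in> D" and "\<phi> q \<noteq> 0"
      using q by (auto simp: S_def)
    then show ?thesis
      using biform_laplacian(1,2)[OF qD normal_sff_H(4)[OF qD]]
        biform_gauss_map(2)[OF qD normal_sff_H(4)[OF qD]]
      unfolding eq[OF qD] by (simp add: biform_tensor_simps)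
  qed
  obtain l where l: "normal_vector z p l"
    "\<And>n. normal_vector z p n \<Longrightarrow> n = - mink n l *\<^sub>R H p - mink n (H p) *\<^sub>R l"
    using conjugate_null_vector[OF p normal_sff_H(4)[OF p] lightlike_H[OF p]] by metis
  have "\<phi> p * biform C (x p) l = 0" "\<phi> p * biform C (y p) l = 0"
    using constant_bivector_annihilates_tangents[OF C S _ CH, of p l] flat S p
    by (auto simp: S_def)
  then have "biform (laplacian z (gauss_map z) p) (x p) l = 0"
    "biform (laplacian z (gauss_map z) p) (y p) l = 0"
    unfolding eq[OF p] by (simp_all add: biform_tensor_simps biform_gauss_map[OF p l(1)])
  then have "mink (D1H p) l = 0" "mink (D2H p) l = 0"
    using biform_laplacian(3,4)[OF p l(1)] by simp_all
  then show "D1H p = 0" "D2H p = 0"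
    using l(2)[OF normal_DH(1)[OF p]] l(2)[OF normal_DH(2)[OF p]] mink_DH_H[OF p] by simp_all
qed

end

theorem theorem4p1:
  fixes D :: "(real \<times> real) set" and z :: "real \<times> real \<Rightarrow> real^4"
  assumes "marginally_trapped D z"
    and "free_of_flat_points D z"
  shows "pointwise_1_type_gauss_map D z \<longleftrightarrow> parallel_mean_curvature D z"
proof -
  interpret trapped D z
    using assms(1) by unfold_locales (auto simp: marginally_trapped_def)
  show ?thesis
  proof
    assume "pointwise_1_type_gauss_map D z"
    then show "parallel_mean_curvature D z"
      using assms(2) pointwise_1_type_imp_parallel
      unfolding pointwise_1_type_gauss_map_def parallel_iff free_of_flat_points_def by meson
  next
    assume "parallel_mean_curvature D z"
    then show "pointwise_1_type_gauss_map D z"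
      unfolding parallel_iff by (intro parallel_imp_pointwise_1_type) blast
  qed
qed

end
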